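(* Let $G$ be a compact (Hausdorff) group, let $\mathfrak K=(\mathfrak E,\mathrm R,\mathbb Z)$ be an I-coherent coabelian classification datum for $G$ and let $C:\mathfrak M\to\mathsf{Ab}$ be a cohomological Mackey functor on an arithmetic Mackey cover $\mathfrak M$ of $\mathfrak E$. Suppose that $C$ satisfies the class field axiom for all $(H,U)\in\mathfrak E_{\mathrm b}$ with $U\ge\mathrm R(H)$ and $H/U$ cyclic of prime order $\ell$, for every prime number $\ell$. Let $\theta:\Pi_{\mathfrak K}\to\widehat{\mathrm H}^0_{\mathfrak E}(C)$ be a $\mathfrak K$-prime morphism. Then $\theta_{(H,U)}$ is an isomorphism for all $(H,U)\in\mathfrak E_{\mathrm b}$ with $U\ge\mathrm R(H)$. Moreover, $\widehat{\mathrm H}^{-1}(C)(H,U)=1$ for all $(H,U)\in\mathfrak E_{\mathrm b}$ with $U\ge\mathrm R(H)$ and $H/U$ cyclic of order $\ell^m$, for every prime number $\ell$ and every $m\in\mathbb N$.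
   Context: $\mathsf{TAb}$ is the category of topological abelian groups; objects of $\mathsf{Ab}$ are regarded as discrete. ${}^gH=gHg^{-1}$, $H^g=g^{-1}Hg$. RIC-functors. A RIC-domain $\mathfrak D$ consists of a non-empty set $\mathfrak D_{\mathrm b}$ with a left action $(g,x)\mapsto{}^gx$ of a group $G$ and, for each $x\in\mathfrak D_{\mathrm b}$, subsets $\mathfrak D_{\mathrm r}(x),\mathfrak D_{\mathrm i}(x)\subseteq\mathfrak D_{\mathrm b}$ such that for $\star\in\{\mathrm r,\mathrm i\}$: $x\in\mathfrak D_\star(x)$; $y\in\mathfrak D_\star(x)$ implies $\mathfrak D_\star(y)\subseteq\mathfrak D_\star(x)$; ${}^g\mathfrak D_\star(x)=\mathfrak D_\star({}^gx)$. A RIC-functor $\Phi:\mathfrak D\to\mathcal C$ into a category $\mathcal C$ consists of objects $\Phi(x)$ and morphisms $\mathrm{res}_{y,x}:\Phi(x)\to\Phi(y)$ ($y\in\mathfrak D_{\mathrm r}(x)$), $\mathrm{ind}_{x,y}:\Phi(y)\to\Phi(x)$ ($y\in\mathfrak D_{\mathrm i}(x)$), $\mathrm{con}_{g,x}:\Phi(x)\to\Phi({}^gx)$ ($g\in G$) such that $\mathrm{res}_{x,x}=\mathrm{ind}_{x,x}=\mathrm{con}_{1,x}=\mathrm{id}$; $\mathrm{res}_{z,y}\mathrm{res}_{y,x}=\mathrm{res}_{z,x}$, $\mathrm{ind}_{x,y}\mathrm{ind}_{y,z}=\mathrm{ind}_{x,z}$, $\mathrm{con}_{g',{}^gx}\mathrm{con}_{g,x}=\mathrm{con}_{g'g,x}$;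 $\mathrm{con}_{g,y}\mathrm{res}_{y,x}=\mathrm{res}_{{}^gy,{}^gx}\mathrm{con}_{g,x}$ and $\mathrm{con}_{g,x}\mathrm{ind}_{x,y}=\mathrm{ind}_{{}^gx,{}^gy}\mathrm{con}_{g,y}$. Morphisms are families $(\varphi_x)$ commuting with res, ind, con; the category is $\mathsf{Fct}(\mathfrak D,\mathcal C)$. Subgroup systems and Mackey functors. A $G$-subgroup system is a RIC-domain $\mathfrak S$ where $\mathfrak S_{\mathrm b}$ is a set of subgroups of $G$ with the conjugation action and $I\le H$ for $I\in\mathfrak S_\star(H)$; $\mathfrak S'\le\mathfrak S$ means $\mathfrak S'_{\mathrm b}\subseteq\mathfrak S_{\mathrm b}$ and $\mathfrak S'_\star(H)\subseteq\mathfrak S_\star(H)$. It is arithmetic if for each $H\in\mathfrak S_{\mathrm b}$ both $\mathfrak S_{\mathrm r}(H)$ and $\mathfrak S_{\mathrm i}(H)$ contain all open subgroups of $H$. It is a $G$-Mackey system if for $I\in\mathfrak S_{\mathrm r}(H)$, $J\in\mathfrak S_{\mathrm i}(H)$ the set $I\backslash H/J$ is finite, $I\cap J\in\mathfrak S_{\mathrm r}(J)$ and $I\cap J\in\mathfrak S_{\mathrm i}(I)$. A RIC-functor on $\mathfrak S$ is stable if $\mathrm{con}_{h,H}=\mathrm{id}$ for $h\in H$. A Mackey functor is a stable RIC-functor on a Mackey system with values in a preadditive category such that $\mathrm{res}_{I,H}\mathrm{ind}_{H,J}=\sum_{h}\mathrm{ind}_{I,I\cap{}^hJ}\,\mathrm{con}_{h,I^h\cap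 J}\,\mathrm{res}_{I^h\cap J,J}$ ($h$ over representatives of $I\backslash H/J$); it is cohomological if $\mathrm{ind}_{H,I}\mathrm{res}_{I,H}=[H:I]\cdot\mathrm{id}$ for $I\in\mathfrak S_{\mathrm r}(H)\cap\mathfrak S_{\mathrm i}(H)$. Groups $C(H)$ are written multiplicatively. $G$-spectra. Let $\mathrm{Grp}^2(G)$ be the set of pairs $(H,U)$, $H$ closed subgroup of $G$, $U$ closed normal subgroup of $H$, ordered componentwise, with componentwise conjugation. A two-dimensional $G$-subgroup system is a RIC-domain $\mathfrak E$ with $\mathfrak E_{\mathrm b}\subseteq\mathrm{Grp}^2(G)$ and $(I,V)\le(H,U)$ for $(I,V)\in\mathfrak E_\star(H,U)$. Put $\mathfrak E^\flat_{\mathrm b}=\{H:(H,U)\in\mathfrak E_{\mathrm b}\text{ for some }U\}$, $\mathrm{Ext}(\mathfrak E,H)=\{U:(H,U)\in\mathfrak E_{\mathrm b}\}$, and $\mathfrak E^\flat_\star(H)$ = set of first components of $\bigcup_{U}\mathfrak E_\star(H,U)$. A $G$-spectrum is such an $\mathfrak E$ for which $\mathfrak E^\flat$ is a $G$-subgroup system, $(I,V)\in\mathfrak E_{\mathrm r}(H,U)$ implies $V=U$, and $[H:I]<\infty$ for $I\in\mathfrak E^\flat_{\mathrm r}(H)$. A Mackey cover of $\mathfrak E$ is a $G$-Mackey system $\mathfrak M$ with $\mathfrak E^\flat\le\mathfrak M$, $\mathrm{Ext}(\mathfrak E,H)\subseteq\mathfrak M_{\mathrm i}(H)$ for all $H\in\mathfrak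 E^\flat_{\mathrm b}$, and $V\in\mathfrak M_{\mathrm i}(U)$ whenever $(I,V)\in\mathfrak E_{\mathrm i}(H,U)$. Transfer and classification data. For $I\le H$ closed of finite index with right transversal $(t_1,\dots,t_n)$ write $t_ih=\kappa(t_ih)t_{\sigma(i)}$ with $\kappa(t_ih)\in I$, $\sigma$ a permutation; for $N\lhd I$ with $I/N$ abelian, $\mathrm V^N_{I,H}:H\to I/N$, $h\mapsto\prod_i\kappa(t_ih)\bmod N$, is a homomorphism independent of the transversal. An abelianization system on $\mathfrak E^\flat$ is a family of closed normal subgroups $\mathrm R(H)\lhd H$ with $H/\mathrm R(H)$ abelian, $\mathrm R({}^gH)={}^g\mathrm R(H)$, $\mathrm R(H)\subseteq\ker\mathrm V^{\mathrm R(I)}_{I,H}$ for $I\in\mathfrak E^\flat_{\mathrm r}(H)$, $\mathrm R(I)\subseteq\mathrm R(H)$ for $I\in\mathfrak E^\flat_{\mathrm i}(H)$. A coabelian classification datum $(\mathfrak E,\mathrm R,\mathbb Z)$ (dualizing functor the constant functor $\mathbb Z$) consists of a $G$-spectrum $\mathfrak E$ and an abelianization system $\mathrm R$ on $\mathfrak E^\flat$. $\Pi_{\mathfrak K}\in\mathsf{Fct}(\mathfrak E,\mathsf{TAb})$ is $\Pi_{\mathfrak K}(H,U)=H/U\mathrm R(H)$ with con induced by conjugation, ind induced by inclusion, and $\mathrm{res}_{(I,U),(H,U)}$ induced by $\mathrm V^{U\mathrm R(I)}_{I,H}$. I-coherence (for $D=\mathbb Z$). $\mathfrak K$ is I-coherent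 if $[H:U]<\infty$ for all $(H,U)\in\mathfrak E_{\mathrm b}$ and for every $H\in\mathfrak E^\flat_{\mathrm b}$: $\mathrm{Ext}(\mathfrak E,H)\subseteq\mathfrak E^\flat_{\mathrm i}(H)$; if $U\in\mathrm{Ext}(\mathfrak E,H)$ and $U_1$ is a closed normal subgroup of $H$ with $U\le U_1$, then $U_1\in\mathrm{Ext}(\mathfrak E,H)$, $U\in\mathrm{Ext}(\mathfrak E,U_1)$, $(U_1,U)\in\mathfrak E_{\mathrm i}(H,U)$ and $(H,U)\in\mathfrak E_{\mathrm i}(H,U_1)$; if $U\in\mathrm{Ext}(\mathfrak E,H)$ and $I$ is an open subgroup of $H$ with $U\le I$, then $(I,U)\in\mathfrak E_{\mathrm i}(H,U)$. (A further condition, surjectivity of $\mathrm{ind}_{(H,U_1),(H,U_2)}$ on $\mathrm{Hom}(\mathbb Z,\Pi_{\mathfrak K})\cong\Pi_{\mathfrak K}$ for $U_2\le U_1$, holds automatically.) Cohomology. $\widehat{\mathrm H}^0_{\mathfrak E}(C)\in\mathsf{Fct}(\mathfrak E,\mathsf{Ab})$ is $(H,U)\mapsto C(H)/\mathrm{ind}^C_{H,U}C(U)$ with structure maps induced by those of $C$ on first components (well defined). For $H\in\mathfrak M_{\mathrm b}$ and $U\in\mathfrak M_{\mathrm i}(H)$ normal in $H$, $\widehat{\mathrm H}^0(C)(H,U)=C(H)/\mathrm{ind}^C_{H,U}C(U)$ and $\widehat{\mathrm H}^{-1}(C)(H,U)=\ker(\mathrm{ind}^C_{H,U})/I_{(H,U)}$,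 where $I_{(H,U)}\le C(U)$ is generated by all $\mathrm{con}^C_{h,U}(x)x^{-1}$, $h\in H$, $x\in C(U)$. $C$ satisfies the class field axiom for $(H,U)$ if $|\widehat{\mathrm H}^0(C)(H,U)|=[H:U]$ and $\widehat{\mathrm H}^{-1}(C)(H,U)=1$. A $\mathfrak K$-prime morphism is a morphism $\theta$ in $\mathsf{Fct}(\mathfrak E,\mathsf{TAb})$ such that $\theta_{(H,U)}$ is an isomorphism for all $(H,U)\in\mathfrak E_{\mathrm b}$ with $U\ge\mathrm R(H)$ and $H/U$ cyclic of prime order. *)

theory Defs
  imports
    "HOL-Algebra.Elementary_Groups"
    "HOL-Algebra.FiniteProduct"
    "HOL-Algebra.Group_Action"
    "HOL-Computational_Algebra.Primes"
    "HOL-Analysis.T1_Spaces"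
begin

section \<open>Topological groups\<close>

record 'a top_group = "'a monoid" +
  topo :: "'a topology"

definition with_topology :: "('a, 'm) monoid_scheme \<Rightarrow> 'a topology \<Rightarrow> 'a top_group" where
  "with_topology A X =
     \<lparr>carrier = carrier A, monoid.mult = monoid.mult A, one = one A, topo = X\<rparr>"

definition quotient_topology :: "'a topology \<Rightarrow> ('a \<Rightarrow> 'b) \<Rightarrow> 'b topology" where
  "quotient_topology X f =
     topology (\<lambda>S. S \<subseteq> f ` topspace X \<and> openin X {x \<in> topspace X. f x \<in> S})"

lemma openin_quotient_topology:
  "openin (quotient_topology X f) S \<longleftrightarrow>
     S \<subseteq> f ` topspace X \<and> openin X {x \<in> topspace X. f x \<in> S}"
proof -
  have "istopology (\<lambda>S. S \<subseteq> f ` topspace X \<and> openin X {x \<in> topspace X. f x \<in> S})"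
    unfolding istopology_def
  proof (intro conjI allI impI)
    fix S T
    assume S: "S \<subseteq> f ` topspace X \<and> openin X {x \<in> topspace X. f x \<in> S}"
      and T: "T \<subseteq> f ` topspace X \<and> openin X {x \<in> topspace X. f x \<in> T}"
    have "{x \<in> topspace X. f x \<in> S \<inter> T} =
        {x \<in> topspace X. f x \<in> S} \<inter> {x \<in> topspace X. f x \<in> T}"
      by blast
    then show "openin X {x \<in> topspace X. f x \<in> S \<inter> T}"
      using S T by auto
    show "S \<inter> T \<subseteq> f ` topspace X"
      using S by blast
  next
    fix \<K>
    assume K: "\<forall>K\<in>\<K>. K \<subseteq> f ` topspace X \<and> openin X {x \<in> topspace X. f x \<in> K}"
    have "{x \<in> topspace X. f x \<in> \<Union>\<K>} = (\<Union>K\<in>\<K>. {x \<in> topspace X. f x \<in> K})"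
      by blast
    then show "openin X {x \<in> topspace X. f x \<in> \<Union>\<K>}"
      using K by auto
    show "\<Union>\<K> \<subseteq> f ` topspace X"
      using K by blast
  qed
  then show ?thesis
    by (simp add: quotient_topology_def topology_inverse')
qed

lemma quotient_map_quotient_topology: "quotient_map X (quotient_topology X f) f"
proof -
  have "{x \<in> topspace X. f x \<in> f ` topspace X} = topspace X"
    by blast
  then have "openin (quotient_topology X f) (f ` topspace X)"
    by (simp add: openin_quotient_topology)
  then have "topspace (quotient_topology X f) = f ` topspace X"
    by (metis openin_quotient_topology openin_subset openin_topspace subset_antisym)
  then show ?thesis
    by (auto simp: quotient_map_def openin_quotient_topology)
qed

definition topological_group :: "'a top_group \<Rightarrow> bool" where
  "topological_group A \<longleftrightarrow>
     group A \<and> topspace (topo A) = carrier A \<and>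
     continuous_map (prod_topology (topo A) (topo A)) (topo A) (\<lambda>(x, y). x \<otimes>\<^bsub>A\<^esub> y) \<and>
     continuous_map (topo A) (topo A) (\<lambda>x. inv\<^bsub>A\<^esub> x)"

definition topological_ab_group :: "'a top_group \<Rightarrow> bool" where
  "topological_ab_group A \<longleftrightarrow> topological_group A \<and> comm_group A"

definition discrete_top_group :: "'a top_group \<Rightarrow> bool" where
  "discrete_top_group A \<longleftrightarrow> topo A = discrete_topology (carrier A)"

definition top_hom :: "'a top_group \<Rightarrow> 'b top_group \<Rightarrow> ('a \<Rightarrow> 'b) set" where
  "top_hom A B = {f \<in> hom A B. continuous_map (topo A) (topo B) f}"

definition top_iso :: "'a top_group \<Rightarrow> 'b top_group \<Rightarrow> ('a \<Rightarrow> 'b) set" where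
  "top_iso A B = {f \<in> iso A B. homeomorphic_map (topo A) (topo B) f}"

section \<open>Subgroups, cosets and the transfer\<close>

definition conj_set :: "('a, 'm) monoid_scheme \<Rightarrow> 'a \<Rightarrow> 'a set \<Rightarrow> 'a set" where
  "conj_set G g H = (g <#\<^bsub>G\<^esub> H) #>\<^bsub>G\<^esub> (inv\<^bsub>G\<^esub> g)"

definition conj_pair ::
    "('a, 'm) monoid_scheme \<Rightarrow> 'a \<Rightarrow> 'a set \<times> 'a set \<Rightarrow> 'a set \<times> 'a set" where
  "conj_pair G g = map_prod (conj_set G g) (conj_set G g)"

abbreviation quot :: "('a, 'm) monoid_scheme \<Rightarrow> 'a set \<Rightarrow> 'a set \<Rightarrow> 'a set monoid" where
  "quot G H U \<equiv> (G\<lparr>carrier := H\<rparr>) Mod U"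

definition finite_index :: "('a, 'm) monoid_scheme \<Rightarrow> 'a set \<Rightarrow> 'a set \<Rightarrow> bool" where
  "finite_index G H I \<longleftrightarrow> finite (rcosets\<^bsub>G\<lparr>carrier := H\<rparr>\<^esub> I)"

definition subgroup_index :: "('a, 'm) monoid_scheme \<Rightarrow> 'a set \<Rightarrow> 'a set \<Rightarrow> nat" where
  "subgroup_index G H I = card (rcosets\<^bsub>G\<lparr>carrier := H\<rparr>\<^esub> I)"

definition cyclic_quotient ::
    "('a, 'm) monoid_scheme \<Rightarrow> 'a set \<Rightarrow> 'a set \<Rightarrow> nat \<Rightarrow> bool" where
  "cyclic_quotient G H U n \<longleftrightarrow> cyclic_group (quot G H U) \<and> order (quot G H U) = n"

definition double_cosets ::
    "('a, 'm) monoid_scheme \<Rightarrow> 'a set \<Rightarrow> 'a set \<Rightarrow> 'a set \<Rightarrow> 'a set set" where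
  "double_cosets G I H J = (\<lambda>h. (I <#>\<^bsub>G\<^esub> {h}) <#>\<^bsub>G\<^esub> J) ` H"

definition representatives :: "'a set set \<Rightarrow> 'a set \<Rightarrow> bool" where
  "representatives P T \<longleftrightarrow> T \<subseteq> \<Union>P \<and> (\<forall>X\<in>P. \<exists>!t. t \<in> T \<and> t \<in> X)"

definition transfer_factor ::
    "('a, 'm) monoid_scheme \<Rightarrow> 'a set \<Rightarrow> 'a set \<Rightarrow> 'a \<Rightarrow> 'a" where
  "transfer_factor G I T x = (THE k. k \<in> I \<and> (\<exists>t\<in>T. x = k \<otimes>\<^bsub>G\<^esub> t))"

text \<open>
  The map \<open>transfer G H I N\<close> goes from \<open>H\<close> to \<open>I / N\<close>. It is independent of the chosen
  transversal when \<open>I\<close> has finite index in \<open>H\<close> and \<open>I / N\<close> is abelian.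
\<close>

definition transfer ::
    "('a, 'm) monoid_scheme \<Rightarrow> 'a set \<Rightarrow> 'a set \<Rightarrow> 'a set \<Rightarrow> 'a \<Rightarrow> 'a set" where
  "transfer G H I N h =
     (let T = (SOME T. representatives (rcosets\<^bsub>G\<lparr>carrier := H\<rparr>\<^esub> I) T)
      in finprod (quot G I N) (\<lambda>t. N #>\<^bsub>G\<^esub> transfer_factor G I T (t \<otimes>\<^bsub>G\<^esub> h)) T)"

text \<open>
  The map on cosets induced by a map \<open>f\<close> that is constant on each coset \<open>X\<close>.
\<close>

abbreviation induced :: "('a \<Rightarrow> 'b) \<Rightarrow> 'a set \<Rightarrow> 'b" where
  "induced f X \<equiv> the_elem (f ` X)"

section \<open>RIC-domains and RIC-functors\<close>

record 'x ric_data =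
  points :: "'x set"
  rdom :: "'x \<Rightarrow> 'x set"
  idom :: "'x \<Rightarrow> 'x set"

locale ric_family =
  fixes G :: "'a top_group" and act :: "'a \<Rightarrow> 'x \<Rightarrow> 'x"
    and B :: "'x set" and S :: "'x \<Rightarrow> 'x set"
  assumes subset: "x \<in> B \<Longrightarrow> S x \<subseteq> B"
    and refl: "x \<in> B \<Longrightarrow> x \<in> S x"
    and trans: "x \<in> B \<Longrightarrow> y \<in> S x \<Longrightarrow> S y \<subseteq> S x"
    and equivariant: "g \<in> carrier G \<Longrightarrow> x \<in> B \<Longrightarrow> act g ` S x = S (act g x)"

text \<open>
  \<^const>\<open>group_action\<close> asks for maps that are extensional on the set acted upon, hence the
  restriction.
\<close>

locale ric_domain =
  fixes G :: "'a top_group" and act :: "'a \<Rightarrow> 'x \<Rightarrow> 'x" and D :: "'x ric_data"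
  assumes nonempty: "points D \<noteq> {}"
    and action: "group_action G (points D) (\<lambda>g. restrict (act g) (points D))"
    and rdom: "ric_family G act (points D) (rdom D)"
    and idom: "ric_family G act (points D) (idom D)"

text \<open>
  In \<open>Res F y x\<close> and \<open>Ind F x y\<close> the target comes first, as in the written notation
  for \<open>y \<in> rdom D x\<close> and \<open>y \<in> idom D x\<close> respectively.
\<close>

record ('x, 'g, 'c) ric_functor_data =
  Obj :: "'x \<Rightarrow> 'c top_group"
  Res :: "'x \<Rightarrow> 'x \<Rightarrow> 'c \<Rightarrow> 'c"
  Ind :: "'x \<Rightarrow> 'x \<Rightarrow> 'c \<Rightarrow> 'c"
  Con :: "'g \<Rightarrow> 'x \<Rightarrow> 'c \<Rightarrow> 'c"

text \<open>
  RIC-functors with values in topological abelian groups. Values in abelian groups are the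
  special case of discrete objects, discrete groups being a full subcategory.
\<close>

locale ric_functor = ric_domain G act D
  for G :: "'a top_group" and act :: "'a \<Rightarrow> 'x \<Rightarrow> 'x" and D :: "'x ric_data" +
  fixes F :: "('x, 'a, 'c) ric_functor_data"
  assumes Obj: "x \<in> points D \<Longrightarrow> topological_ab_group (Obj F x)"
    and Res: "x \<in> points D \<Longrightarrow> y \<in> rdom D x \<Longrightarrow> Res F y x \<in> top_hom (Obj F x) (Obj F y)"
    and Ind: "x \<in> points D \<Longrightarrow> y \<in> idom D x \<Longrightarrow> Ind F x y \<in> top_hom (Obj F y) (Obj F x)"
    and Con: "g \<in> carrier G \<Longrightarrow> x \<in> points D \<Longrightarrow>
          Con F g x \<in> top_hom (Obj F x) (Obj F (act g x))"
    and Res_id: "x \<in> points D \<Longrightarrow> a \<in> carrier (Obj F x) \<Longrightarrow> Res F x x a = a"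
    and Ind_id: "x \<in> points D \<Longrightarrow> a \<in> carrier (Obj F x) \<Longrightarrow> Ind F x x a = a"
    and Con_one: "x \<in> points D \<Longrightarrow> a \<in> carrier (Obj F x) \<Longrightarrow> Con F \<one>\<^bsub>G\<^esub> x a = a"
    and Res_Res: "x \<in> points D \<Longrightarrow> y \<in> rdom D x \<Longrightarrow> z \<in> rdom D y \<Longrightarrow>
          a \<in> carrier (Obj F x) \<Longrightarrow> Res F z y (Res F y x a) = Res F z x a"
    and Ind_Ind: "x \<in> points D \<Longrightarrow> y \<in> idom D x \<Longrightarrow> z \<in> idom D y \<Longrightarrow>
          a \<in> carrier (Obj F z) \<Longrightarrow> Ind F x y (Ind F y z a) = Ind F x z a"
    and Con_Con: "g \<in> carrier G \<Longrightarrow> g' \<in> carrier G \<Longrightarrow> x \<in> points D \<Longrightarrow>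
          a \<in> carrier (Obj F x) \<Longrightarrow>
          Con F g' (act g x) (Con F g x a) = Con F (g' \<otimes>\<^bsub>G\<^esub> g) x a"
    and Con_Res: "g \<in> carrier G \<Longrightarrow> x \<in> points D \<Longrightarrow> y \<in> rdom D x \<Longrightarrow>
          a \<in> carrier (Obj F x) \<Longrightarrow>
          Con F g y (Res F y x a) = Res F (act g y) (act g x) (Con F g x a)"
    and Con_Ind: "g \<in> carrier G \<Longrightarrow> x \<in> points D \<Longrightarrow> y \<in> idom D x \<Longrightarrow>
          a \<in> carrier (Obj F y) \<Longrightarrow>
          Con F g x (Ind F x y a) = Ind F (act g x) (act g y) (Con F g y a)"

locale ric_morphism =
  fixes G :: "'a top_group" and act :: "'a \<Rightarrow> 'x \<Rightarrow> 'x" and D :: "'x ric_data"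
    and F :: "('x, 'a, 'c) ric_functor_data" and F' :: "('x, 'a, 'd) ric_functor_data"
    and \<phi> :: "'x \<Rightarrow> 'c \<Rightarrow> 'd"
  assumes hom: "x \<in> points D \<Longrightarrow> \<phi> x \<in> top_hom (Obj F x) (Obj F' x)"
    and commute_Res: "x \<in> points D \<Longrightarrow> y \<in> rdom D x \<Longrightarrow> a \<in> carrier (Obj F x) \<Longrightarrow>
          \<phi> y (Res F y x a) = Res F' y x (\<phi> x a)"
    and commute_Ind: "x \<in> points D \<Longrightarrow> y \<in> idom D x \<Longrightarrow> a \<in> carrier (Obj F y) \<Longrightarrow>
          \<phi> x (Ind F x y a) = Ind F' x y (\<phi> y a)"
    and commute_Con: "g \<in> carrier G \<Longrightarrow> x \<in> points D \<Longrightarrow> a \<in> carrier (Obj F x) \<Longrightarrow>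
          \<phi> (act g x) (Con F g x a) = Con F' g x (\<phi> x a)"

section \<open>Subgroup systems and Mackey functors\<close>

locale subgroup_system = ric_domain G "conj_set G" S
  for G :: "'a top_group" and S :: "'a set ric_data" +
  assumes subgroups: "H \<in> points S \<Longrightarrow> subgroup H G"
    and rdom_le: "H \<in> points S \<Longrightarrow> I \<in> rdom S H \<Longrightarrow> I \<subseteq> H"
    and idom_le: "H \<in> points S \<Longrightarrow> I \<in> idom S H \<Longrightarrow> I \<subseteq> H"

definition subsystem :: "'a set ric_data \<Rightarrow> 'a set ric_data \<Rightarrow> bool" where
  "subsystem S' S \<longleftrightarrow> points S' \<subseteq> points S \<and>
     (\<forall>H\<in>points S'. rdom S' H \<subseteq> rdom S H \<and> idom S' H \<subseteq> idom S H)"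

definition open_subgroup :: "'a top_group \<Rightarrow> 'a set \<Rightarrow> 'a set \<Rightarrow> bool" where
  "open_subgroup G H I \<longleftrightarrow>
     subgroup I G \<and> I \<subseteq> H \<and> openin (subtopology (topo G) H) I"

definition arithmetic_system :: "'a top_group \<Rightarrow> 'a set ric_data \<Rightarrow> bool" where
  "arithmetic_system G S \<longleftrightarrow>
     (\<forall>H\<in>points S. \<forall>I. open_subgroup G H I \<longrightarrow> I \<in> rdom S H \<and> I \<in> idom S H)"

locale mackey_system = subgroup_system +
  assumes finite_double_cosets: "H \<in> points S \<Longrightarrow> I \<in> rdom S H \<Longrightarrow> J \<in> idom S H \<Longrightarrow>
          finite (double_cosets G I H J)"
    and Int_rdom: "H \<in> points S \<Longrightarrow> I \<in> rdom S H \<Longrightarrow> J \<in> idom S H \<Longrightarrow> I \<inter> J \<in> rdom S J"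
    and Int_idom: "H \<in> points S \<Longrightarrow> I \<in> rdom S H \<Longrightarrow> J \<in> idom S H \<Longrightarrow> I \<inter> J \<in> idom S I"

text \<open>
  Mackey functors with values in abelian groups. By stability every factor of the Mackey
  formula depends only on the double coset, so demanding the formula for all systems of
  representatives is the same as demanding it for one.
\<close>

locale mackey_functor =
  mackey_system G M + ric_functor G "conj_set G" M C
  for G :: "'a top_group" and M :: "'a set ric_data"
    and C :: "('a set, 'a, 'c) ric_functor_data" +
  assumes discrete: "H \<in> points M \<Longrightarrow> discrete_top_group (Obj C H)"
    and stable: "H \<in> points M \<Longrightarrow> h \<in> H \<Longrightarrow> x \<in> carrier (Obj C H) \<Longrightarrow> Con C h H x = x"
    and mackey_formula: "H \<in> points M \<Longrightarrow> I \<in> rdom M H \<Longrightarrow> J \<in> idom M H \<Longrightarrow>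
          representatives (double_cosets G I H J) T \<Longrightarrow> x \<in> carrier (Obj C J) \<Longrightarrow>
          Res C I H (Ind C H J x) =
          finprod (Obj C I)
            (\<lambda>h. let K = conj_set G (inv\<^bsub>G\<^esub> h) I \<inter> J
                 in Ind C I (I \<inter> conj_set G h J) (Con C h K (Res C K J x))) T"

text \<open>
  The index in the condition is that of a subgroup of finite index; for infinite index the
  condition would have no meaning.
\<close>

locale cohomological_mackey_functor = mackey_functor +
  assumes cohomological: "H \<in> points M \<Longrightarrow> I \<in> rdom M H \<inter> idom M H \<Longrightarrow>
          finite_index G H I \<Longrightarrow> x \<in> carrier (Obj C H) \<Longrightarrow>
          Ind C H I (Res C I H x) = x [^]\<^bsub>Obj C H\<^esub> subgroup_index G H I"

section \<open>Spectra and coabelian classification data\<close>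

definition Grp2 :: "'a top_group \<Rightarrow> ('a set \<times> 'a set) set" where
  "Grp2 G = {(H, U). subgroup H G \<and> closedin (topo G) H \<and>
                     U \<lhd> (G\<lparr>carrier := H\<rparr>) \<and> closedin (topo G) U}"

locale two_dim_system = ric_domain G "conj_pair G" E
  for G :: "'a top_group" and E :: "('a set \<times> 'a set) ric_data" +
  assumes pairs: "points E \<subseteq> Grp2 G"
    and rdom_le: "(H, U) \<in> points E \<Longrightarrow> (I, V) \<in> rdom E (H, U) \<Longrightarrow> I \<subseteq> H \<and> V \<subseteq> U"
    and idom_le: "(H, U) \<in> points E \<Longrightarrow> (I, V) \<in> idom E (H, U) \<Longrightarrow> I \<subseteq> H \<and> V \<subseteq> U"

definition Ext :: "('a set \<times> 'a set) ric_data \<Rightarrow> 'a set \<Rightarrow> 'a set set" where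
  "Ext E H = {U. (H, U) \<in> points E}"

definition flat :: "('a set \<times> 'a set) ric_data \<Rightarrow> 'a set ric_data" where
  "flat E = \<lparr>points = fst ` points E,
             rdom = (\<lambda>H. \<Union>U\<in>Ext E H. fst ` rdom E (H, U)),
             idom = (\<lambda>H. \<Union>U\<in>Ext E H. fst ` idom E (H, U))\<rparr>"

locale spectrum = two_dim_system +
  assumes flat_system: "subgroup_system G (flat E)"
    and rdom_snd: "(H, U) \<in> points E \<Longrightarrow> (I, V) \<in> rdom E (H, U) \<Longrightarrow> V = U"
    and flat_rdom_finite_index: "H \<in> points (flat E) \<Longrightarrow> I \<in> rdom (flat E) H \<Longrightarrow>
          finite_index G H I"

locale mackey_cover = mackey_system G M
  for G :: "'a top_group" and E :: "('a set \<times> 'a set) ric_data" and M :: "'a set ric_data" +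
  assumes flat_le: "subsystem (flat E) M"
    and Ext_le: "H \<in> points (flat E) \<Longrightarrow> Ext E H \<subseteq> idom M H"
    and idom_snd: "(H, U) \<in> points E \<Longrightarrow> (I, V) \<in> idom E (H, U) \<Longrightarrow> V \<in> idom M U"

locale abelianization_system =
  fixes G :: "'a top_group" and E :: "('a set \<times> 'a set) ric_data"
    and R :: "'a set \<Rightarrow> 'a set"
  assumes R_closed: "H \<in> points (flat E) \<Longrightarrow> closedin (topo G) (R H)"
    and R_normal: "H \<in> points (flat E) \<Longrightarrow> R H \<lhd> (G\<lparr>carrier := H\<rparr>)"
    and R_abelian: "H \<in> points (flat E) \<Longrightarrow> comm_group (quot G H (R H))"
    and R_conj: "g \<in> carrier G \<Longrightarrow> H \<in> points (flat E) \<Longrightarrow>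
          R (conj_set G g H) = conj_set G g (R H)"
    and R_rdom: "H \<in> points (flat E) \<Longrightarrow> I \<in> rdom (flat E) H \<Longrightarrow> h \<in> R H \<Longrightarrow>
          transfer G H I (R I) h = \<one>\<^bsub>quot G I (R I)\<^esub>"
    and R_idom: "H \<in> points (flat E) \<Longrightarrow> I \<in> idom (flat E) H \<Longrightarrow> R I \<subseteq> R H"

text \<open>
  Coabelian classification data whose dualizing functor is the constant functor \<open>\<int>\<close>, which
  therefore does not occur as a parameter.
\<close>

locale coabelian_datum = spectrum G E + abelianization_system G E R
  for G :: "'a top_group" and E :: "('a set \<times> 'a set) ric_data" and R :: "'a set \<Rightarrow> 'a set"

definition Pi_functor ::
    "'a top_group \<Rightarrow> ('a set \<Rightarrow> 'a set) \<Rightarrow> ('a set \<times> 'a set, 'a, 'a set) ric_functor_data" where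
  "Pi_functor G R =
    \<lparr>Obj = (\<lambda>(H, U). let N = U <#>\<^bsub>G\<^esub> R H
              in with_topology (quot G H N)
                   (quotient_topology (subtopology (topo G) H) (\<lambda>h. N #>\<^bsub>G\<^esub> h))),
     Res = (\<lambda>(I, V) (H, U). induced (transfer G H I (V <#>\<^bsub>G\<^esub> R I))),
     Ind = (\<lambda>(H, U) (I, V). induced (\<lambda>h. (U <#>\<^bsub>G\<^esub> R H) #>\<^bsub>G\<^esub> h)),
     Con = (\<lambda>g (H, U). induced (\<lambda>h.
              (conj_set G g U <#>\<^bsub>G\<^esub> R (conj_set G g H))
                #>\<^bsub>G\<^esub> (g \<otimes>\<^bsub>G\<^esub> h \<otimes>\<^bsub>G\<^esub> inv\<^bsub>G\<^esub> g)))\<rparr>"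

text \<open>
  Surjectivity of the inductions between the groups \<open>Hom(\<int>, \<Pi>(H, U)) \<cong> H / U R(H)\<close>,
  also part of I-coherence for a general dualizing functor, is automatic here.
\<close>

locale I_coherent = coabelian_datum +
  assumes finite_quotients: "(H, U) \<in> points E \<Longrightarrow> finite_index G H U"
    and Ext_idom: "H \<in> points (flat E) \<Longrightarrow> Ext E H \<subseteq> idom (flat E) H"
    and intermediate_normal:
      "H \<in> points (flat E) \<Longrightarrow> U \<in> Ext E H \<Longrightarrow> (H, U1) \<in> Grp2 G \<Longrightarrow> U \<subseteq> U1 \<Longrightarrow>
        U1 \<in> Ext E H \<and> U \<in> Ext E U1 \<and>
        (U1, U) \<in> idom E (H, U) \<and> (H, U) \<in> idom E (H, U1)"
    and intermediate_open:
      "H \<in> points (flat E) \<Longrightarrow> U \<in> Ext E H \<Longrightarrow> open_subgroup G H I \<Longrightarrow> U \<subseteq> I \<Longrightarrow>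
        (I, U) \<in> idom E (H, U)"

section \<open>Cohomology\<close>

definition norm_group :: "('a set, 'g, 'c) ric_functor_data \<Rightarrow> 'a set \<Rightarrow> 'a set \<Rightarrow> 'c set" where
  "norm_group C H U = Ind C H U ` carrier (Obj C U)"

definition H0 :: "('a set, 'g, 'c) ric_functor_data \<Rightarrow> 'a set \<Rightarrow> 'a set \<Rightarrow> 'c set monoid" where
  "H0 C H U = Obj C H Mod norm_group C H U"

definition H0_functor ::
    "'a top_group \<Rightarrow> ('a set, 'a, 'c) ric_functor_data
       \<Rightarrow> ('a set \<times> 'a set, 'a, 'c set) ric_functor_data" where
  "H0_functor G C =
    \<lparr>Obj = (\<lambda>(H, U). with_topology (H0 C H U) (discrete_topology (carrier (H0 C H U)))),
     Res = (\<lambda>(I, V) (H, U). induced (\<lambda>x. norm_group C I V #>\<^bsub>Obj C I\<^esub> Res C I H x)),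
     Ind = (\<lambda>(H, U) (I, V). induced (\<lambda>x. norm_group C H U #>\<^bsub>Obj C H\<^esub> Ind C H I x)),
     Con = (\<lambda>g (H, U). induced (\<lambda>x.
              norm_group C (conj_set G g H) (conj_set G g U)
                #>\<^bsub>Obj C (conj_set G g H)\<^esub> Con C g H x))\<rparr>"

definition aug_group :: "('a set, 'a, 'c) ric_functor_data \<Rightarrow> 'a set \<Rightarrow> 'a set \<Rightarrow> 'c set" where
  "aug_group C H U = generate (Obj C U)
     {Con C h U x \<otimes>\<^bsub>Obj C U\<^esub> inv\<^bsub>Obj C U\<^esub> x | h x. h \<in> H \<and> x \<in> carrier (Obj C U)}"

definition Hm1 :: "('a set, 'a, 'c) ric_functor_data \<Rightarrow> 'a set \<Rightarrow> 'a set \<Rightarrow> 'c set monoid" where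
  "Hm1 C H U = quot (Obj C U) (kernel (Obj C U) (Obj C H) (Ind C H U)) (aug_group C H U)"

text \<open>
  Both \<^const>\<open>order\<close> and \<^const>\<open>subgroup_index\<close> are \<open>0\<close> on infinite sets; finiteness is
  stated so that this convention cannot satisfy the equation.
\<close>

definition class_field_axiom ::
    "'a top_group \<Rightarrow> ('a set, 'a, 'c) ric_functor_data \<Rightarrow> 'a set \<Rightarrow> 'a set \<Rightarrow> bool" where
  "class_field_axiom G C H U \<longleftrightarrow>
     finite_index G H U \<and> finite (carrier (H0 C H U)) \<and>
     order (H0 C H U) = subgroup_index G H U \<and> trivial_group (Hm1 C H U)"

locale prime_morphism =
  ric_morphism G "conj_pair G" E "Pi_functor G R" "H0_functor G C" \<theta>
  for G :: "'a top_group" and E :: "('a set \<times> 'a set) ric_data" and R :: "'a set \<Rightarrow> 'a set"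
    and C :: "('a set, 'a, 'c) ric_functor_data"
    and \<theta> :: "'a set \<times> 'a set \<Rightarrow> 'a set \<Rightarrow> 'c set" +
  assumes prime_iso: "(H, U) \<in> points E \<Longrightarrow> R H \<subseteq> U \<Longrightarrow> prime l \<Longrightarrow> cyclic_quotient G H U l \<Longrightarrow>
          \<theta> (H, U) \<in> top_iso (Obj (Pi_functor G R) (H, U)) (Obj (H0_functor G C) (H, U))"

end

theory Submission
  imports Defs "HOL-Algebra.Multiplicative_Group"
begin

text \<open>
  Both claims go by induction on \<open>[H : U]\<close>, through an intermediate group \<open>U \<le> K < H\<close> of prime
  index in \<open>H\<close>. The class field axiom and the prime morphism settle \<open>(H, K)\<close>, and the induction
  hypothesis settles \<open>(K, U)\<close>. Surjectivity of \<open>\<theta>\<close> at \<open>(H, U)\<close> is a diagram chase in the exact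
  sequence \<open>C(K)/N C(U) \<rightarrow> C(H)/N C(U) \<rightarrow> C(H)/N C(K) \<rightarrow> 1\<close>. For injectivity the first map has to
  be injective: since \<open>H\<^sup>-\<^sup>1(H, K) = 1\<close>, its kernel comes from the elements \<open>h z / z\<close> of \<open>C(K)\<close>, and
  these are norms from \<open>U\<close> because \<open>H\<close> acts trivially on \<open>K / U\<close>, which \<open>\<theta>\<close> identifies
  equivariantly with \<open>C(K)/N C(U)\<close>. Vanishing of \<open>H\<^sup>-\<^sup>1\<close> then holds for every cyclic \<open>H / U\<close>.
\<close>

section \<open>Abelian quotients and subgroups of prime index\<close>

text \<open>The hypotheses speak only of quotients of prime order, so everything else has to be
  carried from (H, K) and (K, U) to (H, U). Finite index of U makes every group between U and H
  closed, and open in H; I-coherence then puts (H, K) and (K, U) into the spectrum together with the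
  inductions that link them to (H, U), and \<open>R K \<subseteq> R H\<close> keeps them within the
  range of the theorem. Finite index also makes the quotients H / U discrete, so that only
  bijectivity of \<open>\<theta>\<close> is at stake. As both sides of \<open>\<theta>\<close> are
  groups of cosets, the chases are run on a relation \<open>reciprocity\<close> between elements of
  H and of C(H). The second claim rests on the first, at (K, U) as well as at (H, U). Cyclicity
  serves there twice: it reduces the augmentation group to elements s z / z with one fixed s, and it
  makes every element of K / U a q-th power in H / U, where q = [H : K].\<close>

lemma (in group) conj_set_eq:
  assumes "subgroup H G" "K \<lhd> (G\<lparr>carrier := H\<rparr>)" "h \<in> H"
  shows "conj_set G h K = K"
proof -
  have "K \<subseteq> H"
    using normal_imp_subgroup[OF assms(2)] subgroup.subset by force
  then have K: "K \<subseteq> carrier G"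
    using assms(1) subgroup.subset by blast
  have h: "h \<in> carrier G"
    using assms(1,3) subgroup.mem_carrier by metis
  have "h <# K = K #> h"
    using normal.coset_eq[OF assms(2)] assms(3) by simp
  then show ?thesis
    using K h by (simp add: conj_set_def coset_mult_assoc)
qed

text \<open>A conjugate of h by x is the commutator of x and h, times h.\<close>

lemma (in group) normal_if_commutators:
  assumes "subgroup K G" "\<And>a b. \<lbrakk>a \<in> carrier G; b \<in> carrier G\<rbrakk> \<Longrightarrow> a \<otimes> b \<otimes> inv a \<otimes> inv b \<in> K"
  shows "K \<lhd> G"
proof -
  have "x \<otimes> h \<otimes> inv x \<in> K" if "x \<in> carrier G" "h \<in> K" for x h
  proof -
    have h: "h \<in> carrier G"
      using assms(1) that(2) subgroup.mem_carrier by metis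
    have "x \<otimes> h \<otimes> inv x = x \<otimes> h \<otimes> inv x \<otimes> inv h \<otimes> h"
      using that(1) h by (simp add: m_assoc)
    then show ?thesis
      by (metis assms(1) assms(2)[OF that(1) h] that(2) subgroup.m_closed)
  qed
  then show ?thesis
    using assms(1) normal_inv_iff by blast
qed

text \<open>Every a other than one generates, hence has order |G|. For a divisor d of |G| strictly
  between 1 and |G|, the power a^d would have order |G| / d and yet generate.\<close>

lemma (in group) prime_order_if_no_proper_subgroup:
  assumes fin: "finite (carrier G)" and nontriv: "carrier G \<noteq> {\<one>}"
    and simple: "\<And>S. subgroup S G \<Longrightarrow> S = {\<one>} \<or> S = carrier G"
  shows "cyclic_group G \<and> prime (order G)"
proof -
  have gen: "generate G {a} = carrier G" if "a \<in> carrier G" "a \<noteq> \<one>" for a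
  proof -
    have "a \<in> generate G {a}"
      by (simp add: generate.incl)
    then show ?thesis
      using simple[OF generate_is_subgroup[of "{a}"]] that by auto
  qed
  obtain a where a: "a \<in> carrier G" "a \<noteq> \<one>"
    using nontriv one_closed by blast
  have ord_eq: "ord b = order G" if "b \<in> carrier G" "b \<noteq> \<one>" for b
    using that generate_pow_card gen by (simp add: order_def)
  have pos: "order G > 0"
    using fin by (simp add: order_gt_0_iff_finite)
  have "carrier G = range (\<lambda>n::int. a [^] n)"
    using gen[OF a] generate_pow[OF a(1)] by (simp add: full_SetCompr_eq)
  then have cyc: "cyclic_group G"
    using cyclic_group a(1) by blast
  have "order G \<noteq> 1"
    using ord_eq[OF a] ord_eq_1[OF a(1)] a(2) by simp
  moreover have "d = 1 \<or> d = order G" if d: "d dvd order G" for d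
  proof (rule ccontr)
    assume *: "\<not> (d = 1 \<or> d = order G)"
    have d0: "d \<noteq> 0"
      using d pos by auto
    have "d < order G"
      using d pos * by (simp add: dvd_imp_le le_neq_implies_less)
    then have "\<not> ord a dvd d"
      using ord_eq[OF a] d0 by (simp add: nat_dvd_not_less)
    then have "a [^] d \<noteq> \<one>"
      using pow_eq_id a(1) by blast
    then have "ord (a [^] d) = order G"
      using a(1) ord_eq by simp
    moreover have "ord (a [^] d) = order G div d"
      using ord_pow[OF a(1)] d d0 ord_eq[OF a] by simp
    ultimately have "order G = order G div d"
      by simp
    then show False
      using pos * d0 by (metis One_nat_def Suc_lessI div_less_dividend less_irrefl neq0_conv)
  qed
  ultimately have "prime (order G)"
    using pos by (auto simp: prime_nat_iff)
  with cyc show ?thesis by blast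
qed

text \<open>K is maximal among the proper subgroups containing N, so G / K has no proper nontrivial
  subgroup. Size is measured by the number of N-cosets, which is finite although G may be infinite.
  The commutator condition expresses that G / N is abelian, and makes K normal.\<close>

lemma (in group) ex_prime_index_subgroup:
  assumes N: "subgroup N G"
    and comm: "\<And>a b. \<lbrakk>a \<in> carrier G; b \<in> carrier G\<rbrakk> \<Longrightarrow> a \<otimes> b \<otimes> inv a \<otimes> inv b \<in> N"
    and fin: "finite (rcosets N)" and proper: "N \<noteq> carrier G"
  obtains K where "subgroup K G" "N \<subseteq> K" "K \<noteq> carrier G" "K \<lhd> G"
    "cyclic_group (G Mod K)" "prime (order (G Mod K))"
proof -
  define P where "P K \<longleftrightarrow> subgroup K G \<and> N \<subseteq> K \<and> K \<noteq> carrier G" for K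
  define m where "m K = card ((#>) N ` K)" for K
  have sub: "(#>) N ` K \<subseteq> rcosets N" if "subgroup K G" for K
    using subgroup.subset[OF that] by (auto simp: RCOSETS_def)
  have bound: "m K < Suc (card (rcosets N))" if "P K" for K
    using that card_mono[OF fin sub] unfolding P_def m_def by (simp add: less_Suc_eq_le)
  obtain K where K: "P K" and max: "\<And>L. P L \<Longrightarrow> m L \<le> m K"
    using ex_has_greatest_nat[of P N m "Suc (card (rcosets N))"] bound N proper
    by (metis P_def order_refl)
  have grow: "m K < m L" if L: "subgroup L G" "K \<subset> L" for L
  proof -
    obtain x where x: "x \<in> L" "x \<notin> K"
      using L(2) by blast
    have xG: "x \<in> carrier G"
      using x(1) L(1) subgroup.mem_carrier by metis
    have "N #> x \<notin> (#>) N ` K"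
    proof
      assume "N #> x \<in> (#>) N ` K"
      then obtain k where k: "k \<in> K" "N #> x = N #> k" by blast
      have "x \<in> N #> k"
        using rcos_self[OF xG N] k(2) by simp
      then obtain n where "n \<in> N" "x = n \<otimes> k"
        by (auto simp: r_coset_def)
      then show False
        using x(2) k(1) K by (metis P_def subgroup.m_closed subsetD)
    qed
    then have "(#>) N ` K \<subset> (#>) N ` L"
      using x(1) L(2) by blast
    then show ?thesis
      unfolding m_def by (rule psubset_card_mono[OF finite_subset[OF sub[OF L(1)] fin]])
  qed
  have KG: "subgroup K G" and NK: "N \<subseteq> K" and Kp: "K \<noteq> carrier G"
    using K by (auto simp: P_def)
  have normal: "K \<lhd> G"
    using normal_if_commutators[OF KG] comm NK by blast
  interpret K: normal K G by (fact normal)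
  interpret Q: group "G Mod K" by (fact K.factorgroup_is_group)
  interpret h: group_hom G "G Mod K" "(#>) K"
    by unfold_locales (rule K.r_coset_hom_Mod)
  have carrier_Q: "carrier (G Mod K) = (#>) K ` carrier G"
    by (rule carrier_FactGroup)
  have one_Q: "\<one>\<^bsub>G Mod K\<^esub> = K"
    by simp
  have coset_eq_K: "x \<in> K" if "x \<in> carrier G" "K #> x = K" for x
    using rcos_self[OF that(1) KG] that(2) by simp
  \<comment> \<open>Sending an N-coset to the K-coset containing it presents G / K as an image of a
    finite set.\<close>
  have "carrier (G Mod K) = (\<lambda>X. \<Union>x\<in>X. K #> x) ` (rcosets N)"
  proof -
    have "(\<Union>x\<in>N #> a. K #> x) = K #> a" if "a \<in> carrier G" for a
    proof -
      have "N #> a \<subseteq> K #> a"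
        using NK by (auto simp: r_coset_def)
      then have "K #> x = K #> a" if "x \<in> N #> a" for x
        using repr_independence[OF _ \<open>a \<in> carrier G\<close> KG] that by blast
      moreover have "N #> a \<noteq> {}"
        using rcos_self[OF that N] by blast
      ultimately show ?thesis by auto
    qed
    then show ?thesis
      by (auto simp: carrier_Q RCOSETS_def image_UN image_iff)
  qed
  then have "finite (carrier (G Mod K))"
    using fin by simp
  moreover have "carrier (G Mod K) \<noteq> {\<one>\<^bsub>G Mod K\<^esub>}"
  proof
    assume "carrier (G Mod K) = {\<one>\<^bsub>G Mod K\<^esub>}"
    then have "carrier G \<subseteq> K"
      using coset_eq_K unfolding carrier_Q one_Q by (metis imageI singletonD subsetI)
    then show False
      using Kp subgroup.subset[OF KG] by blast
  qed
  moreover have "S = {\<one>\<^bsub>G Mod K\<^esub>} \<or> S = carrier (G Mod K)" if S: "subgroup S (G Mod K)" for S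
  proof -
    \<comment> \<open>The preimage of S contains K, so by maximality it is K or all of G.\<close>
    define L where "L = {x \<in> carrier G. K #> x \<in> S}"
    have L: "subgroup L G"
    proof
      show "inv x \<in> L" if "x \<in> L" for x
        using that subgroup.m_inv_closed[OF S, of "K #> x"] h.hom_inv[of x] by (auto simp: L_def)
      show "x \<otimes> y \<in> L" if "x \<in> L" "y \<in> L" for x y
        using that subgroup.m_closed[OF S, of "K #> x" "K #> y"] h.hom_mult[of x y]
        by (auto simp: L_def)
      show "\<one> \<in> L"
        using subgroup.one_closed[OF S] h.hom_one by (auto simp: L_def)
    qed (auto simp: L_def)
    have SL: "S = (#>) K ` L"
      using subgroup.subset[OF S] unfolding carrier_Q by (auto simp: L_def)
    have KL: "K \<subseteq> L"
    proof
      fix k assume k: "k \<in> K"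
      then have "K #> k = K" "k \<in> carrier G"
        using coset_join2[OF _ KG] K.mem_carrier by auto
      then show "k \<in> L"
        using subgroup.one_closed[OF S] by (simp add: L_def)
    qed
    have "\<not> (K \<subset> L \<and> L \<noteq> carrier G)"
      using grow[OF L] max[of L] L KL NK by (force simp: P_def)
    then have "L = K \<or> L = carrier G"
      using KL by blast
    then show ?thesis
    proof
      assume "L = K"
      then have "S = (\<lambda>_. K) ` K"
        using SL K.mem_carrier coset_join2[OF _ KG] by auto
      then have "S = {K}"
        by (simp add: image_constant[OF K.one_closed])
      then show ?thesis by simp
    next
      assume "L = carrier G"
      then show ?thesis using SL carrier_Q by simp
    qed
  qed
  ultimately have "cyclic_group (G Mod K) \<and> prime (order (G Mod K))"
    by (rule Q.prime_order_if_no_proper_subgroup)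
  then show thesis
    using that KG NK Kp normal by blast
qed

text \<open>The class of s in G / K is not trivial, since otherwise all powers of s, and with them
  G, would lie in K. Its order is therefore the prime |G / K|, and a power of s lies in K only if
  this prime divides the exponent.\<close>

lemma (in group) cyclic_mod_prime_index:
  assumes N: "subgroup N G" "N \<subseteq> K" and K: "K \<lhd> G" and proper: "K \<noteq> carrier G"
    and q: "prime (order (G Mod K))"
    and s: "s \<in> carrier G" "\<And>x. x \<in> carrier G \<Longrightarrow> \<exists>k::nat. N #> x = N #> s [^] k"
  shows "s [^] order (G Mod K) \<in> K"
    and "x \<in> K \<Longrightarrow> \<exists>k::nat. N #> x = N #> (s [^] order (G Mod K)) [^] k"
proof -
  interpret K: normal K G by (fact K)
  interpret Q: group "G Mod K" by (fact K.factorgroup_is_group)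
  let ?q = "order (G Mod K)"
  have sQ: "K #> s \<in> carrier (G Mod K)"
    using s(1) by (auto simp: carrier_FactGroup)
  have pow: "(K #> s) [^]\<^bsub>G Mod K\<^esub> k = \<one>\<^bsub>G Mod K\<^esub> \<longleftrightarrow> s [^] k \<in> K" for k :: nat
    using s(1) coset_join1[OF _ _ K.is_subgroup] coset_join2[OF _ K.is_subgroup] K.subset
    by (auto simp: K.FactGroup_pow)
  show sq: "s [^] ?q \<in> K"
    using pow Q.pow_order_eq_1[OF sQ] by blast
  have in_K: "y \<in> K" if "N #> x = N #> y" "x \<in> K" "y \<in> carrier G" for x y
  proof -
    have "y \<in> N #> x"
      using rcos_self[OF that(3) N(1)] that(1) by simp
    then show ?thesis
      using that(2) N(2) by (auto simp: r_coset_def)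
  qed
  have "s \<notin> K"
  proof
    assume "s \<in> K"
    have sk: "s [^] k \<in> K" for k :: nat
      using \<open>s \<in> K\<close> by (induction k) auto
    have "carrier G \<subseteq> K"
    proof
      fix x assume x: "x \<in> carrier G"
      then obtain k :: nat where "N #> x = N #> s [^] k"
        using s(2) by blast
      then show "x \<in> K"
        using in_K[of "s [^] k" x] x sk by simp
    qed
    then show False
      using proper K.subset by blast
  qed
  then have "Q.ord (K #> s) \<noteq> 1"
    using pow[of 1] Q.pow_eq_id[OF sQ, of 1] s(1) by simp
  moreover have "Q.ord (K #> s) dvd ?q"
    by (rule Q.ord_dvd_group_order[OF sQ])
  ultimately have ord: "Q.ord (K #> s) = ?q"
    using q by (auto simp: prime_nat_iff)
  assume x: "x \<in> K"
  then obtain k :: nat where k: "N #> x = N #> s [^] k"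
    using s(2) K.mem_carrier by blast
  then have "s [^] k \<in> K"
    by (rule in_K) (use x s(1) in simp_all)
  then have "?q dvd k"
    using pow[of k] Q.pow_eq_id[OF sQ, of k] ord by simp
  then obtain j where "k = ?q * j"
    by blast
  then show "\<exists>k::nat. N #> x = N #> (s [^] ?q) [^] k"
    using k s(1) by (auto simp: nat_pow_pow)
qed

text \<open>With S = R(H) contained in U, this collapses the subgroup U R(H) of
  \<open>Pi_functor\<close> to U.\<close>

lemma (in group) set_mult_subset_eq:
  assumes "subgroup U G" "S \<subseteq> U" "\<one> \<in> S"
  shows "U <#> S = U"
proof
  show "U <#> S \<subseteq> U"
    using assms(2) subgroup.m_closed[OF assms(1)] by (auto simp: set_mult_def)
  show "U \<subseteq> U <#> S"
  proof
    fix x assume "x \<in> U"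
    then have "x = x \<otimes> \<one>"
      using subgroup.mem_carrier[OF assms(1)] by simp
    then show "x \<in> U <#> S"
      using \<open>x \<in> U\<close> assms(3) unfolding set_mult_def by blast
  qed
qed

lemma induced_eq:
  "\<lbrakk>x \<in> X; \<And>y. y \<in> X \<Longrightarrow> f y = f x\<rbrakk> \<Longrightarrow> induced f X = f x"
  by (metis (no_types, lifting) image_cong image_constant the_elem_eq)

section \<open>Cosets of closed subgroups\<close>

lemma closedin_r_coset:
  fixes G :: "'a top_group" (structure)
  assumes "topological_group G" "closedin (topo G) S" "g \<in> carrier G"
  shows "closedin (topo G) (S #>\<^bsub>G\<^esub> g)"
proof -
  interpret group G
    using assms(1) by (simp add: topological_group_def)
  have top: "topspace (topo G) = carrier G"
    using assms(1) by (simp add: topological_group_def)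
  have "continuous_map (prod_topology (topo G) (topo G)) (topo G) (\<lambda>(x, y). x \<otimes>\<^bsub>G\<^esub> y)"
    using assms(1) by (simp add: topological_group_def)
  moreover have "continuous_map (topo G) (prod_topology (topo G) (topo G)) (\<lambda>x. (x, inv g))"
    using assms(3) top by (simp add: continuous_map_paired)
  ultimately have "continuous_map (topo G) (topo G) ((\<lambda>(x, y). x \<otimes>\<^bsub>G\<^esub> y) \<circ> (\<lambda>x. (x, inv g)))"
    by (rule continuous_map_compose[rotated])
  then have "closedin (topo G) {x \<in> topspace (topo G). ((\<lambda>(x, y). x \<otimes>\<^bsub>G\<^esub> y) \<circ> (\<lambda>x. (x, inv g))) x \<in> S}"
    using assms(2) by (rule closedin_continuous_map_preimage)
  moreover have "{x \<in> carrier G. x \<otimes>\<^bsub>G\<^esub> inv g \<in> S} = S #>\<^bsub>G\<^esub> g"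
  proof -
    have S: "S \<subseteq> carrier G"
      using closedin_subset[OF assms(2)] top by simp
    have "x = (x \<otimes> inv g) \<otimes> g" if "x \<in> carrier G" for x
      using that assms(3) by (simp add: m_assoc)
    then have "x \<in> S #> g" if "x \<in> carrier G" "x \<otimes> inv g \<in> S" for x
      using that unfolding r_coset_def by blast
    moreover have "s \<otimes> g \<in> carrier G \<and> s \<otimes> g \<otimes> inv g \<in> S" if "s \<in> S" for s
      using that S assms(3) by (simp add: m_assoc subset_eq)
    ultimately show ?thesis
      by (auto simp: r_coset_def)
  qed
  ultimately show ?thesis
    by (simp add: top)
qed

text \<open>There are only finitely many cosets, each of them closed as a translate. This holds for
  any choice T of cosets, hence also for complements of such unions, which is how openness is
  obtained.\<close>

lemma closedin_UN_r_coset: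
  fixes G :: "'a top_group" (structure)
  assumes "topological_group G" "closedin (topo G) U" "finite_index G H U"
    and "H \<subseteq> carrier G" "T \<subseteq> H"
  shows "closedin (topo G) (\<Union>t\<in>T. U #>\<^bsub>G\<^esub> t)"
proof (rule closedin_Union)
  have "(#>\<^bsub>G\<^esub>) U ` T \<subseteq> rcosets\<^bsub>G\<lparr>carrier := H\<rparr>\<^esub> U"
    using assms(5) by (auto simp: RCOSETS_def)
  then show "finite ((#>\<^bsub>G\<^esub>) U ` T)"
    using assms(3) unfolding finite_index_def by (rule finite_subset)
  show "closedin (topo G) X" if "X \<in> (#>\<^bsub>G\<^esub>) U ` T" for X
    using that closedin_r_coset[OF assms(1,2)] assms(4,5) by auto
qed

lemma quotient_topology_discrete:
  fixes G :: "'a top_group" (structure)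
  assumes "topological_group G" "subgroup H G" "subgroup U G" "U \<subseteq> H"
    and "closedin (topo G) U" "finite_index G H U"
  shows "quotient_topology (subtopology (topo G) H) (\<lambda>h. U #>\<^bsub>G\<^esub> h) =
    discrete_topology (carrier (quot G H U))"
proof -
  interpret group G
    using assms(1) by (simp add: topological_group_def)
  have top: "topspace (topo G) = carrier G"
    using assms(1) by (simp add: topological_group_def)
  have H: "H \<subseteq> carrier G"
    using assms(2) subgroup.subset by blast
  have in_H: "x \<in> H" if "x \<in> U #> h" "h \<in> H" for x h
    using that assms(4) subgroup.m_closed[OF assms(2)] by (auto simp: r_coset_def)
  have topH: "topspace (subtopology (topo G) H) = H"
    using H top by auto
  have carr: "carrier (quot G H U) = (\<lambda>h. U #> h) ` H"
    by (simp add: carrier_FactGroup)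
  have "openin (subtopology (topo G) H) {h \<in> H. U #> h \<in> S}" for S
  proof -
    \<comment> \<open>The preimage of S is the complement in H of the cosets outside S, and these
      form a closed set.\<close>
    let ?T = "{h \<in> H. U #> h \<notin> S}"
    have "x \<notin> (\<Union>t\<in>?T. U #> t)" if "x \<in> H" "U #> x \<in> S" for x
      using that repr_independence[OF _ _ assms(3)] H by auto
    moreover have "x \<in> (\<Union>t\<in>?T. U #> t)" if "x \<in> H" "U #> x \<notin> S" for x
      using that rcos_self[OF _ assms(3)] H by auto
    ultimately have "{h \<in> H. U #> h \<in> S} = H - (\<Union>t\<in>?T. U #> t)"
      by blast
    moreover have "closedin (topo G) (\<Union>t\<in>?T. U #> t)"
      using assms H by (intro closedin_UN_r_coset) auto
    then have "openin (topo G) (carrier G - (\<Union>t\<in>?T. U #> t))"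
      by (metis openin_closedin_eq top closedin_def)
    moreover have "H - (\<Union>t\<in>?T. U #> t) = (carrier G - (\<Union>t\<in>?T. U #> t)) \<inter> H"
      using H by blast
    ultimately show ?thesis
      by (auto simp: openin_subtopology)
  qed
  then show ?thesis
    unfolding topology_eq openin_quotient_topology topH carr openin_discrete_topology by simp
qed

section \<open>Layers of the spectrum\<close>

locale class_field_setting =
  IC: I_coherent G E R + MC: mackey_cover G E M + CF: cohomological_mackey_functor G M C +
  PM: prime_morphism G E R C \<theta>
  for G :: "'a top_group" and E :: "('a set \<times> 'a set) ric_data" and R :: "'a set \<Rightarrow> 'a set"
    and M :: "'a set ric_data" and C :: "('a set, 'a, 'c) ric_functor_data"
    and \<theta> :: "'a set \<times> 'a set \<Rightarrow> 'a set \<Rightarrow> 'c set" +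
  assumes topological_group: "topological_group G"
    and arithmetic: "arithmetic_system G M"
    and prime_axiom: "\<lbrakk>(H, U) \<in> points E; R H \<subseteq> U; prime l; cyclic_quotient G H U l\<rbrakk>
      \<Longrightarrow> class_field_axiom G C H U"
begin

sublocale G: group G
  using topological_group by (simp add: topological_group_def)

text \<open>The pairs that the theorem is about. Since H / R(H) is abelian, so is H / U, and U R(H)
  = U, so that the group of \<open>Pi_functor\<close> at (H, U) is H / U.\<close>

definition layer :: "'a set \<Rightarrow> 'a set \<Rightarrow> bool" where
  "layer H U \<longleftrightarrow> (H, U) \<in> points E \<and> R H \<subseteq> U"

lemma layerD:
  assumes "layer H U"
  shows "subgroup H G" "subgroup U G" "U \<lhd> (G\<lparr>carrier := H\<rparr>)" "U \<subseteq> H" "closedin (topo G) U"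
    "finite_index G H U" "H \<in> points (flat E)" "U \<in> Ext E H"
proof -
  have p: "(H, U) \<in> points E" and "(H, U) \<in> Grp2 G"
    using assms IC.pairs by (auto simp: layer_def)
  then show H: "subgroup H G" and U: "U \<lhd> (G\<lparr>carrier := H\<rparr>)" and "closedin (topo G) U"
    by (auto simp: Grp2_def)
  show "U \<subseteq> H"
    using subgroup.subset[OF normal_imp_subgroup[OF U]] by simp
  show "subgroup U G"
    using G.incl_subgroup[OF H normal_imp_subgroup[OF U]] .
  show "finite_index G H U"
    using IC.finite_quotients p by blast
  show "H \<in> points (flat E)" "U \<in> Ext E H"
    using p by (force simp: flat_def Ext_def)+
qed

lemma layer_Mackey:
  assumes "layer H U"
  shows "H \<in> points M" "U \<in> idom M H" "U \<in> points M"
proof -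
  show H: "H \<in> points M"
    using MC.flat_le layerD[OF assms] by (auto simp: subsystem_def)
  show U: "U \<in> idom M H"
    using MC.Ext_le layerD[OF assms] by blast
  show "U \<in> points M"
    using ric_family.subset[OF MC.idom H] U by blast
qed

text \<open>Commutativity of H / U in terms of elements of G. It yields both the normality of all
  intermediate groups and the trivial action of H on K / U.\<close>

lemma layer_commutator:
  assumes "layer H U" "a \<in> H" "b \<in> H"
  shows "a \<otimes>\<^bsub>G\<^esub> b \<otimes>\<^bsub>G\<^esub> inv\<^bsub>G\<^esub> a \<otimes>\<^bsub>G\<^esub> inv\<^bsub>G\<^esub> b \<in> U"
proof -
  note L = layerD[OF assms(1)]
  have ab: "a \<in> carrier G" "b \<in> carrier G"
    using assms L(1) subgroup.mem_carrier by metis+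
  have N: "R H \<lhd> (G\<lparr>carrier := H\<rparr>)"
    using IC.R_normal L by blast
  have RG: "subgroup (R H) G"
    using G.incl_subgroup[OF L(1) normal_imp_subgroup[OF N]] .
  have Q: "comm_group (quot G H (R H))"
    using IC.R_abelian L by blast
  have in_H: "a \<otimes>\<^bsub>G\<^esub> b \<in> H" "b \<otimes>\<^bsub>G\<^esub> a \<in> H"
    using assms subgroup.m_closed[OF L(1)] by auto
  have "R H #>\<^bsub>G\<^esub> (a \<otimes>\<^bsub>G\<^esub> b) = R H #>\<^bsub>G\<^esub> (b \<otimes>\<^bsub>G\<^esub> a)"
    using comm_groupE(4)[OF Q, of "R H #>\<^bsub>G\<^esub> a" "R H #>\<^bsub>G\<^esub> b"]
      normal.rcos_sum[OF N, of a b] normal.rcos_sum[OF N, of b a] assms(2,3)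
    by (auto simp: carrier_FactGroup)
  then have "a \<otimes>\<^bsub>G\<^esub> b \<in> R H #>\<^bsub>G\<^esub> (b \<otimes>\<^bsub>G\<^esub> a)"
    using G.rcos_self[OF _ RG, of "a \<otimes>\<^bsub>G\<^esub> b"] ab by simp
  then have "(a \<otimes>\<^bsub>G\<^esub> b) \<otimes>\<^bsub>G\<^esub> inv\<^bsub>G\<^esub> (b \<otimes>\<^bsub>G\<^esub> a) \<in> R H"
    using subgroup.rcos_module_imp[OF RG G.group_axioms] ab by simp
  then show ?thesis
    using assms(1) ab by (auto simp: layer_def G.inv_mult_group G.m_assoc)
qed

section \<open>Groups between U and H\<close>

lemma normal_intermediate:
  assumes "layer H U" "subgroup K G" "U \<subseteq> K" "K \<subseteq> H"
  shows "K \<lhd> (G\<lparr>carrier := H\<rparr>)"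
proof -
  note L = layerD[OF assms(1)]
  interpret H: group "G\<lparr>carrier := H\<rparr>"
    using L(1) by (simp add: G.subgroup_imp_group)
  have "subgroup K (G\<lparr>carrier := H\<rparr>)"
    using G.subgroup_incl[OF assms(2) L(1) assms(4)] .
  then show ?thesis
    by (rule H.normal_if_commutators) (use L(1) layer_commutator[OF assms(1)] assms(3) in auto)
qed

text \<open>K is a finite union of cosets of the closed group U, hence closed, and I-coherence
  applies to it. The last conclusion supplies restriction from H to K, which the cohomological
  formula requires.\<close>

lemma intermediate:
  assumes "layer H U" "subgroup K G" "U \<subseteq> K" "K \<subseteq> H"
  shows "layer H K" "layer K U" "(K, U) \<in> idom E (H, U)" "(H, U) \<in> idom E (H, K)"
    "K \<in> rdom M H"
proof -
  note L = layerD[OF assms(1)]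
  have H: "H \<subseteq> carrier G"
    using L(1) subgroup.subset by blast
  have K: "K = (\<Union>k\<in>K. U #>\<^bsub>G\<^esub> k)"
  proof
    show "K \<subseteq> (\<Union>k\<in>K. U #>\<^bsub>G\<^esub> k)"
      using G.rcos_self[OF _ L(2)] assms(4) H by blast
    show "(\<Union>k\<in>K. U #>\<^bsub>G\<^esub> k) \<subseteq> K"
      using assms(3) subgroup.m_closed[OF assms(2)] by (auto simp: r_coset_def)
  qed
  have closed: "closedin (topo G) K"
    by (subst K) (rule closedin_UN_r_coset[OF topological_group L(5,6) H assms(4)])
  have pair: "(H, K) \<in> Grp2 G"
    using IC.pairs assms(1) closed normal_intermediate[OF assms]
    by (auto simp: Grp2_def layer_def)
  have *: "K \<in> Ext E H" "U \<in> Ext E K" "(K, U) \<in> idom E (H, U)" "(H, U) \<in> idom E (H, K)"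
    using IC.intermediate_normal[OF L(7,8) pair assms(3)] by auto
  \<comment> \<open>K is an extension group of H, hence lies in \<open>idom (flat E) H\<close>;
    there R is monotone.\<close>
  have "R K \<subseteq> R H"
    using IC.R_idom[OF L(7)] IC.Ext_idom[OF L(7)] *(1) by blast
  then show "layer H K" "layer K U"
    using assms * by (auto simp: layer_def Ext_def)
  show "(K, U) \<in> idom E (H, U)" "(H, U) \<in> idom E (H, K)"
    by fact+
  \<comment> \<open>The complement is a union of U-cosets as well, so K is open in H and
    arithmeticity of M applies.\<close>
  have "H - K = (\<Union>h\<in>H - K. U #>\<^bsub>G\<^esub> h)"
  proof
    show "H - K \<subseteq> (\<Union>h\<in>H - K. U #>\<^bsub>G\<^esub> h)"
      using G.rcos_self[OF _ L(2)] H by blast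
    have "u \<otimes>\<^bsub>G\<^esub> h \<in> H - K" if "u \<in> U" "h \<in> H - K" for u h
    proof -
      have "u \<in> carrier G" "h \<in> carrier G"
        using that L(4) H by auto
      then have "h = inv\<^bsub>G\<^esub> u \<otimes>\<^bsub>G\<^esub> (u \<otimes>\<^bsub>G\<^esub> h)"
        by (simp add: G.m_assoc[symmetric])
      then have "u \<otimes>\<^bsub>G\<^esub> h \<notin> K"
        using that assms(3) subgroup.m_closed[OF assms(2)] subgroup.m_inv_closed[OF assms(2)]
        by (metis DiffD2 subsetD)
      then show ?thesis
        using that L(4) subgroup.m_closed[OF L(1)] by blast
    qed
    then show "(\<Union>h\<in>H - K. U #>\<^bsub>G\<^esub> h) \<subseteq> H - K"
      by (auto simp: r_coset_def)
  qed
  then have "closedin (topo G) (H - K)"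
    using closedin_UN_r_coset[OF topological_group L(5,6) H, of "H - K"] by simp
  then have "openin (topo G) (topspace (topo G) - (H - K))"
    by (simp add: closedin_def)
  moreover have "K = (topspace (topo G) - (H - K)) \<inter> H"
    using assms(4) H topological_group by (auto simp: topological_group_def)
  ultimately have "openin (subtopology (topo G) H) K"
    by (auto simp: openin_subtopology)
  then show "K \<in> rdom M H"
    using arithmetic layer_Mackey(1)[OF assms(1)] assms(2,4)
    by (auto simp: arithmetic_system_def open_subgroup_def)
qed

lemma obtain_prime_layer:
  assumes "layer H U" "U \<noteq> H"
  obtains K q where "subgroup K G" "U \<subseteq> K" "K \<subset> H" "prime q" "cyclic_quotient G H K q"
proof -
  note L = layerD[OF assms(1)]
  interpret H: group "G\<lparr>carrier := H\<rparr>"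
    using L(1) by (simp add: G.subgroup_imp_group)
  have sub: "subgroup U (G\<lparr>carrier := H\<rparr>)"
    using L(3) normal_imp_subgroup by blast
  have fin: "finite (rcosets\<^bsub>G\<lparr>carrier := H\<rparr>\<^esub> U)"
    using L(6) by (simp add: finite_index_def)
  have comm: "a \<otimes>\<^bsub>G\<lparr>carrier := H\<rparr>\<^esub> b \<otimes>\<^bsub>G\<lparr>carrier := H\<rparr>\<^esub> inv\<^bsub>G\<lparr>carrier := H\<rparr>\<^esub> a
      \<otimes>\<^bsub>G\<lparr>carrier := H\<rparr>\<^esub> inv\<^bsub>G\<lparr>carrier := H\<rparr>\<^esub> b \<in> U"
    if "a \<in> carrier (G\<lparr>carrier := H\<rparr>)" "b \<in> carrier (G\<lparr>carrier := H\<rparr>)" for a b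
    using that layer_commutator[OF assms(1)] L(1) by simp
  obtain K where K: "subgroup K (G\<lparr>carrier := H\<rparr>)" "U \<subseteq> K" "K \<noteq> H"
    "cyclic_group (quot G H K)" "prime (order (quot G H K))"
    by (rule H.ex_prime_index_subgroup[OF sub comm fin]) (use assms(2) in auto)
  show thesis
  proof
    show "subgroup K G"
      using G.incl_subgroup[OF L(1) K(1)] .
    show "K \<subset> H"
      using subgroup.subset[OF K(1)] K(3) by auto
    show "cyclic_quotient G H K (order (quot G H K))"
      using K by (simp add: cyclic_quotient_def)
  qed (use K in auto)
qed

text \<open>The measure of both inductions: a U-coset of an element of H outside K is not contained
  in K, and there are only finitely many U-cosets in H.\<close>

lemma index_less:
  assumes "layer H U" "K \<subset> H" "U \<subseteq> K" "subgroup K G"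
  shows "subgroup_index G K U < subgroup_index G H U"
proof -
  note L = layerD[OF assms(1)]
  obtain h where h: "h \<in> H" "h \<notin> K"
    using assms(2) by blast
  have hG: "h \<in> carrier G"
    using h L(1) subgroup.mem_carrier by metis
  have "U #>\<^bsub>G\<^esub> h \<notin> rcosets\<^bsub>G\<lparr>carrier := K\<rparr>\<^esub> U"
  proof
    assume "U #>\<^bsub>G\<^esub> h \<in> rcosets\<^bsub>G\<lparr>carrier := K\<rparr>\<^esub> U"
    then obtain k where k: "k \<in> K" "h \<in> U #>\<^bsub>G\<^esub> k"
      using G.rcos_self[OF hG L(2)] by (auto simp: RCOSETS_def)
    then show False
      using h(2) assms(3) subgroup.m_closed[OF assms(4)] by (auto simp: r_coset_def)
  qed
  moreover have "U #>\<^bsub>G\<^esub> h \<in> rcosets\<^bsub>G\<lparr>carrier := H\<rparr>\<^esub> U"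
    using h(1) by (auto simp: RCOSETS_def)
  moreover have "rcosets\<^bsub>G\<lparr>carrier := K\<rparr>\<^esub> U \<subseteq> rcosets\<^bsub>G\<lparr>carrier := H\<rparr>\<^esub> U"
    using assms(2) by (auto simp: RCOSETS_def)
  ultimately have "rcosets\<^bsub>G\<lparr>carrier := K\<rparr>\<^esub> U \<subset> rcosets\<^bsub>G\<lparr>carrier := H\<rparr>\<^esub> U"
    by blast
  then show ?thesis
    using L(6) unfolding subgroup_index_def finite_index_def by (rule psubset_card_mono[rotated])
qed

section \<open>Norm classes\<close>

lemma Obj_comm_group: "H \<in> points M \<Longrightarrow> comm_group (Obj C H)"
  using CF.Obj by (simp add: topological_ab_group_def)

lemma Ind_hom: "H \<in> points M \<Longrightarrow> U \<in> idom M H \<Longrightarrow> Ind C H U \<in> hom (Obj C U) (Obj C H)"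
  using CF.Ind by (simp add: top_hom_def)

lemma Ind_group_hom:
  assumes "H \<in> points M" "U \<in> points M" "U \<in> idom M H"
  shows "group_hom (Obj C U) (Obj C H) (Ind C H U)"
  using assms Obj_comm_group Ind_hom
  by (simp add: group_hom_def group_hom_axioms_def comm_group_def)

definition norm_class :: "'a set \<Rightarrow> 'a set \<Rightarrow> 'c \<Rightarrow> 'c set" where
  "norm_class H U z = norm_group C H U #>\<^bsub>Obj C H\<^esub> z"

lemma norm_group_normal:
  assumes "H \<in> points M" "U \<in> points M" "U \<in> idom M H"
  shows "norm_group C H U \<lhd> Obj C H"
proof -
  interpret h: group_hom "Obj C U" "Obj C H" "Ind C H U"
    using Ind_group_hom[OF assms] .
  have "subgroup (norm_group C H U) (Obj C H)"
    unfolding norm_group_def by (rule h.img_is_subgroup)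
  then show ?thesis
    using Obj_comm_group[OF assms(1)] comm_group.subgroup_imp_normal by blast
qed

lemma norm_class_eq_iff:
  assumes "H \<in> points M" "U \<in> points M" "U \<in> idom M H"
    and z: "z \<in> carrier (Obj C H)" "z' \<in> carrier (Obj C H)"
  shows "norm_class H U z = norm_class H U z' \<longleftrightarrow>
    (\<exists>y\<in>carrier (Obj C U). z = Ind C H U y \<otimes>\<^bsub>Obj C H\<^esub> z')"
proof -
  interpret H: comm_group "Obj C H"
    using Obj_comm_group[OF assms(1)] .
  have N: "subgroup (norm_group C H U) (Obj C H)"
    using norm_group_normal[OF assms(1-3)] normal_imp_subgroup by blast
  have "norm_class H U z = norm_class H U z' \<longleftrightarrow> z \<in> norm_class H U z'"
    using H.repr_independence[OF _ z(2) N] H.rcos_self[OF z(1) N] unfolding norm_class_def by blast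
  then show ?thesis
    by (auto simp: norm_class_def r_coset_def norm_group_def)
qed

lemma mem_norm_class:
  assumes "H \<in> points M" "U \<in> points M" "U \<in> idom M H"
    and z: "z \<in> carrier (Obj C H)" "x \<in> norm_class H U z"
  shows "x \<in> carrier (Obj C H)" "norm_class H U x = norm_class H U z"
proof -
  interpret H: comm_group "Obj C H"
    using Obj_comm_group[OF assms(1)] .
  have N: "subgroup (norm_group C H U) (Obj C H)"
    using norm_group_normal[OF assms(1-3)] normal_imp_subgroup by blast
  show "x \<in> carrier (Obj C H)"
    using z subgroup.elemrcos_carrier[OF N H.is_group] unfolding norm_class_def by blast
  show "norm_class H U x = norm_class H U z"
    using H.repr_independence[OF _ z(1) N] z(2) unfolding norm_class_def by blast
qed

lemma carrier_H0: "carrier (H0 C H U) = norm_class H U ` carrier (Obj C H)"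
  by (simp add: H0_def carrier_FactGroup norm_class_def[abs_def])

section \<open>Conjugation and the augmentation group\<close>

lemma Con_hom:
  assumes "H \<in> points M" "g \<in> carrier G" "conj_set G g H = H"
  shows "group_hom (Obj C H) (Obj C H) (Con C g H)"
  using assms CF.Con[of g H] Obj_comm_group
  by (simp add: top_hom_def group_hom_def group_hom_axioms_def comm_group_def)

lemma conj_layer:
  assumes "layer H U" "subgroup K G" "U \<subseteq> K" "K \<subseteq> H" "g \<in> H"
  shows "conj_set G g K = K"
  using G.conj_set_eq[OF layerD(1)[OF assms(1)] normal_intermediate[OF assms(1-4)] assms(5)] .

text \<open>Induction commutes with conjugation, and by stability h acts trivially on C(H). So x and
  its conjugate have the same norm.\<close>

lemma aug_subset_kernel:
  assumes "layer H U"
  shows "aug_group C H U \<subseteq> kernel (Obj C U) (Obj C H) (Ind C H U)"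
proof -
  note L = layerD[OF assms] and P = layer_Mackey[OF assms]
  interpret h: group_hom "Obj C U" "Obj C H" "Ind C H U"
    using Ind_group_hom P by blast
  have "Con C h U x \<otimes>\<^bsub>Obj C U\<^esub> inv\<^bsub>Obj C U\<^esub> x \<in> kernel (Obj C U) (Obj C H) (Ind C H U)"
    if h: "h \<in> H" and x: "x \<in> carrier (Obj C U)" for h x
  proof -
    have hG: "h \<in> carrier G"
      using h L(1) subgroup.mem_carrier by metis
    have conj: "conj_set G h U = U" "conj_set G h H = H"
      using conj_layer[OF assms] L h by auto
    interpret c: group_hom "Obj C U" "Obj C U" "Con C h U"
      using Con_hom P hG conj by blast
    have "Ind C H U (Con C h U x) = Con C h H (Ind C H U x)"
      using CF.Con_Ind[OF hG P(1,2) x] conj by simp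
    also have "\<dots> = Ind C H U x"
      using CF.stable[OF P(1) h] x by simp
    finally show ?thesis
      using x by (simp add: kernel_def)
  qed
  then show ?thesis
    unfolding aug_group_def using h.subgroup_kernel
    by (intro h.G.generate_subgroup_incl) auto
qed

lemma trivial_Hm1_iff:
  assumes "layer H U"
  shows "trivial_group (Hm1 C H U) \<longleftrightarrow>
    (\<forall>x\<in>carrier (Obj C U). Ind C H U x = \<one>\<^bsub>Obj C H\<^esub> \<longrightarrow> x \<in> aug_group C H U)"
proof -
  note P = layer_Mackey[OF assms]
  interpret h: group_hom "Obj C U" "Obj C H" "Ind C H U"
    using Ind_group_hom P by blast
  interpret U: comm_group "Obj C U"
    using Obj_comm_group P by blast
  let ?K = "kernel (Obj C U) (Obj C H) (Ind C H U)"
  let ?A = "aug_group C H U"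
  have AU: "subgroup ?A (Obj C U)"
    unfolding aug_group_def
  proof (rule h.G.generate_is_subgroup, clarify)
    fix h x assume "h \<in> H" and x: "x \<in> carrier (Obj C U)"
    then have "Con C h U x \<otimes>\<^bsub>Obj C U\<^esub> inv\<^bsub>Obj C U\<^esub> x \<in> ?A"
      unfolding aug_group_def by (blast intro: generate.incl)
    then show "Con C h U x \<otimes>\<^bsub>Obj C U\<^esub> inv\<^bsub>Obj C U\<^esub> x \<in> carrier (Obj C U)"
      using aug_subset_kernel[OF assms] by (auto simp: kernel_def)
  qed
  have A: "?A \<lhd> (Obj C U\<lparr>carrier := ?K\<rparr>)"
    using h.G.normal_restrict_supergroup[OF h.subgroup_kernel U.subgroup_imp_normal[OF AU]
        aug_subset_kernel[OF assms]] .
  interpret Q: group "Hm1 C H U"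
    unfolding Hm1_def using normal.factorgroup_is_group[OF A] .
  have carr: "carrier (Hm1 C H U) = (\<lambda>x. ?A #>\<^bsub>Obj C U\<^esub> x) ` ?K" and one: "\<one>\<^bsub>Hm1 C H U\<^esub> = ?A"
    by (simp_all add: Hm1_def carrier_FactGroup)
  have coset: "?A #>\<^bsub>Obj C U\<^esub> x = ?A \<longleftrightarrow> x \<in> ?A" if "x \<in> ?K" for x
    using that h.G.coset_join1[OF _ _ AU, of x] h.G.coset_join2[OF _ AU, of x] subgroup.subset[OF AU]
    by (auto simp: kernel_def)
  have "trivial_group (Hm1 C H U) \<longleftrightarrow> (\<forall>x\<in>?K. ?A #>\<^bsub>Obj C U\<^esub> x = ?A)"
    unfolding Q.trivial_group_subset carr one by blast
  then show ?thesis
    using coset by (auto simp: kernel_def)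
qed

section \<open>The relation defined by the reciprocity morphism\<close>

text \<open>The two equations belong to the layers (K, U) and (H, K); the first uses that R(K) lies
  in U. Taking K = H gives the layer (H, U) itself.\<close>

lemma layer_set_mult:
  assumes "layer H U" "subgroup K G" "U \<subseteq> K" "K \<subseteq> H"
  shows "U <#>\<^bsub>G\<^esub> R K = U" "K <#>\<^bsub>G\<^esub> R H = K"
proof -
  have *: "\<one>\<^bsub>G\<^esub> \<in> R X" if "X \<in> points (flat E)" for X
    using subgroup.one_closed[OF normal_imp_subgroup[OF IC.R_normal[OF that]]] by simp
  have KU: "layer K U"
    using intermediate[OF assms] by blast
  show "U <#>\<^bsub>G\<^esub> R K = U"
    using G.set_mult_subset_eq layerD[OF KU] KU * by (simp add: layer_def)
  show "K <#>\<^bsub>G\<^esub> R H = K"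
    using G.set_mult_subset_eq[OF assms(2), of "R H"] layerD[OF assms(1)] assms * 
    by (auto simp: layer_def)
qed

lemma Pi_Obj:
  assumes "layer H U"
  shows "Obj (Pi_functor G R) (H, U) =
    with_topology (quot G H U) (discrete_topology (carrier (quot G H U)))"
  using layer_set_mult(1)[OF assms layerD(1)[OF assms]] layerD[OF assms]
    quotient_topology_discrete[OF topological_group, of H U]
  by (simp add: Pi_functor_def)

lemma theta_hom:
  assumes "layer H U"
  shows "group_hom (quot G H U) (H0 C H U) (\<theta> (H, U))"
proof -
  have "\<theta> (H, U) \<in> hom (quot G H U) (H0 C H U)"
    using PM.hom[of "(H, U)"] Pi_Obj[OF assms] assms
    by (simp add: layer_def top_hom_def H0_functor_def with_topology_def hom_def)
  moreover have "group (quot G H U)"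
    using normal.factorgroup_is_group[OF layerD(3)[OF assms]] .
  moreover have "group (H0 C H U)"
    unfolding H0_def using normal.factorgroup_is_group[OF norm_group_normal] layer_Mackey[OF assms]
    by blast
  ultimately show ?thesis
    by (simp add: group_hom_def group_hom_axioms_def)
qed

text \<open>Both topologies are discrete, the one on H / U because U is closed of finite index.
  Continuity is thus automatic in both directions.\<close>

lemma top_iso_iff:
  assumes "layer H U"
  shows "\<theta> (H, U) \<in> top_iso (Obj (Pi_functor G R) (H, U)) (Obj (H0_functor G C) (H, U)) \<longleftrightarrow>
    bij_betw (\<theta> (H, U)) (carrier (quot G H U)) (carrier (H0 C H U))"
proof -
  interpret h: group_hom "quot G H U" "H0 C H U" "\<theta> (H, U)"
    using theta_hom[OF assms] .
  have "homeomorphic_map (discrete_topology (carrier (quot G H U)))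
    (discrete_topology (carrier (H0 C H U))) (\<theta> (H, U))"
    if "bij_betw (\<theta> (H, U)) (carrier (quot G H U)) (carrier (H0 C H U))"
    using that by (auto simp: homeomorphic_map_def quotient_map_def bij_betw_def)
  then show ?thesis
    using h.homh Pi_Obj[OF assms]
    by (auto simp: top_iso_def iso_def H0_functor_def with_topology_def hom_def)
qed

text \<open>Says that \<open>\<theta>\<close> takes the class of h to the class of z. A relation on
  representatives spares the passage through cosets: it is multiplicative, and the naturality of
  \<open>\<theta>\<close> turns into rules on h and z.\<close>

definition reciprocity :: "'a set \<Rightarrow> 'a set \<Rightarrow> 'a \<Rightarrow> 'c \<Rightarrow> bool" where
  "reciprocity H U h z \<longleftrightarrow>
    h \<in> H \<and> z \<in> carrier (Obj C H) \<and> \<theta> (H, U) (U #>\<^bsub>G\<^esub> h) = norm_class H U z"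

lemma reciprocity_ex:
  assumes "layer H U" "h \<in> H"
  obtains z where "reciprocity H U h z"
proof -
  interpret h: group_hom "quot G H U" "H0 C H U" "\<theta> (H, U)"
    using theta_hom[OF assms(1)] .
  have "\<theta> (H, U) (U #>\<^bsub>G\<^esub> h) \<in> carrier (H0 C H U)"
    using assms(2) by (intro h.hom_closed) (simp add: carrier_FactGroup)
  then show thesis
    using that assms(2) by (auto simp: carrier_H0 reciprocity_def)
qed

lemma reciprocity_mult:
  assumes "layer H U" "reciprocity H U h z" "reciprocity H U h' z'"
  shows "reciprocity H U (h \<otimes>\<^bsub>G\<^esub> h') (z \<otimes>\<^bsub>Obj C H\<^esub> z')"
proof -
  note L = layerD[OF assms(1)] and P = layer_Mackey[OF assms(1)]
  interpret h: group_hom "quot G H U" "H0 C H U" "\<theta> (H, U)"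
    using theta_hom[OF assms(1)] .
  interpret H: comm_group "Obj C H"
    using Obj_comm_group P by blast
  have hz: "h \<in> H" "h' \<in> H" "z \<in> carrier (Obj C H)" "z' \<in> carrier (Obj C H)"
    using assms(2,3) by (auto simp: reciprocity_def)
  have "(U #>\<^bsub>G\<^esub> h) <#>\<^bsub>G\<^esub> (U #>\<^bsub>G\<^esub> h') = U #>\<^bsub>G\<^esub> (h \<otimes>\<^bsub>G\<^esub> h')"
    using normal.rcos_sum[OF L(3), of h h'] hz by simp
  moreover have "norm_class H U z <#>\<^bsub>Obj C H\<^esub> norm_class H U z' = norm_class H U (z \<otimes>\<^bsub>Obj C H\<^esub> z')"
    unfolding norm_class_def using normal.rcos_sum[OF norm_group_normal[OF P(1,3,2)]] hz by blast
  moreover have "\<theta> (H, U) ((U #>\<^bsub>G\<^esub> h) <#>\<^bsub>G\<^esub> (U #>\<^bsub>G\<^esub> h')) =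
    \<theta> (H, U) (U #>\<^bsub>G\<^esub> h) <#>\<^bsub>Obj C H\<^esub> \<theta> (H, U) (U #>\<^bsub>G\<^esub> h')"
    using h.hom_mult[of "U #>\<^bsub>G\<^esub> h" "U #>\<^bsub>G\<^esub> h'"] hz by (simp add: carrier_FactGroup H0_def)
  ultimately show ?thesis
    using assms(2,3) hz subgroup.m_closed[OF L(1)] by (simp add: reciprocity_def)
qed

lemma reciprocity_one:
  assumes "layer H U"
  shows "reciprocity H U \<one>\<^bsub>G\<^esub> \<one>\<^bsub>Obj C H\<^esub>"
proof -
  note L = layerD[OF assms] and P = layer_Mackey[OF assms]
  interpret h: group_hom "quot G H U" "H0 C H U" "\<theta> (H, U)"
    using theta_hom[OF assms(1)] .
  interpret H: comm_group "Obj C H"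
    using Obj_comm_group P by blast
  have "norm_class H U \<one>\<^bsub>Obj C H\<^esub> = norm_group C H U"
    unfolding norm_class_def
    using H.coset_mult_one subgroup.subset normal_imp_subgroup norm_group_normal P by metis
  moreover have "U #>\<^bsub>G\<^esub> \<one>\<^bsub>G\<^esub> = U"
    using G.coset_mult_one subgroup.subset[OF L(2)] by blast
  ultimately show ?thesis
    using h.hom_one subgroup.one_closed[OF L(1)] by (simp add: reciprocity_def H0_def)
qed

lemma reciprocity_pow:
  assumes "layer H U" "reciprocity H U h z"
  shows "reciprocity H U (h [^]\<^bsub>G\<^esub> n) (z [^]\<^bsub>Obj C H\<^esub> (n::nat))"
  using reciprocity_one[OF assms(1)] reciprocity_mult[OF assms(1) _ assms(2)]
  by (induction n) auto

lemma reciprocity_cong: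
  assumes "reciprocity H U h z" "h' \<in> H" "z' \<in> carrier (Obj C H)"
    and "U #>\<^bsub>G\<^esub> h = U #>\<^bsub>G\<^esub> h'" "norm_class H U z = norm_class H U z'"
  shows "reciprocity H U h' z'"
  using assms by (simp add: reciprocity_def)

lemma reciprocity_unique:
  "\<lbrakk>reciprocity H U h z; reciprocity H U h z'\<rbrakk> \<Longrightarrow> norm_class H U z = norm_class H U z'"
  by (simp add: reciprocity_def)

section \<open>Naturality of the relation under induction and conjugation\<close>

lemma norm_class_Ind:
  assumes "layer H U" "subgroup K G" "U \<subseteq> K" "K \<subseteq> H" 
    and z: "z \<in> carrier (Obj C K)" "z' \<in> carrier (Obj C K)" "norm_class K U z = norm_class K U z'"
  shows "norm_class H U (Ind C H K z) = norm_class H U (Ind C H K z')"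
proof -
  note I = intermediate[OF assms(1-4)]
  note HK = layer_Mackey[OF I(1)] and KU = layer_Mackey[OF I(2)] and HU = layer_Mackey[OF assms(1)]
  interpret h: group_hom "Obj C K" "Obj C H" "Ind C H K"
    using Ind_group_hom HK by blast
  interpret g: group_hom "Obj C U" "Obj C K" "Ind C K U"
    using Ind_group_hom KU by blast
  obtain y where y: "y \<in> carrier (Obj C U)" "z = Ind C K U y \<otimes>\<^bsub>Obj C K\<^esub> z'"
    using z norm_class_eq_iff[OF KU(1,3,2) z(1,2)] by blast
  then have "Ind C H K z = Ind C H U y \<otimes>\<^bsub>Obj C H\<^esub> Ind C H K z'"
    using z CF.Ind_Ind[OF HK(1,2) KU(2) y(1)] by simp
  then show ?thesis
    using norm_class_eq_iff[OF HU(1,3,2) h.hom_closed[OF z(1)] h.hom_closed[OF z(2)]] y(1) by blast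
qed

lemma coset_rep:
  assumes "layer H U" "h \<in> H" "x \<in> U #>\<^bsub>G\<^esub> h"
  shows "U #>\<^bsub>G\<^esub> x = U #>\<^bsub>G\<^esub> h" "x \<in> H"
proof -
  note L = layerD[OF assms(1)]
  have "h \<in> carrier G"
    using assms(2) L(1) subgroup.mem_carrier by metis
  then show "U #>\<^bsub>G\<^esub> x = U #>\<^bsub>G\<^esub> h"
    using G.repr_independence[OF assms(3) _ L(2)] by simp
  show "x \<in> H"
    using assms(2,3) L(4) subgroup.m_closed[OF L(1)] by (auto simp: r_coset_def)
qed

lemma self_mem_coset:
  assumes "layer H U" "h \<in> H"
  shows "h \<in> U #>\<^bsub>G\<^esub> h"
  using G.rcos_self layerD[OF assms(1)] assms(2) subgroup.mem_carrier by metis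

lemma self_mem_norm_class:
  assumes "layer H U" "z \<in> carrier (Obj C H)"
  shows "z \<in> norm_class H U z"
proof -
  interpret H: comm_group "Obj C H"
    using Obj_comm_group layer_Mackey[OF assms(1)] by blast
  show ?thesis
    unfolding norm_class_def
    using H.rcos_self norm_group_normal normal_imp_subgroup layer_Mackey[OF assms(1)] assms(2)
    by blast
qed

text \<open>Naturality of \<open>\<theta>\<close> for the induction from (K, U) to (H, U), which is
  the inclusion of K / U into H / U on one side and the norm from K to H on the other. Most of the
  work is to evaluate \<open>induced\<close> on cosets.\<close>

lemma reciprocity_Ind:
  assumes "layer H U" "subgroup K G" "U \<subseteq> K" "K \<subseteq> H" and r: "reciprocity K U k z"
  shows "reciprocity H U k (Ind C H K z)"
proof -
  note I = intermediate[OF assms(1-4)]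
  note HK = layer_Mackey[OF I(1)] and KU = layer_Mackey[OF I(2)]
  interpret h: group_hom "Obj C K" "Obj C H" "Ind C H K"
    using Ind_group_hom HK by blast
  have kz: "k \<in> K" "z \<in> carrier (Obj C K)" "\<theta> (K, U) (U #>\<^bsub>G\<^esub> k) = norm_class K U z"
    using r by (auto simp: reciprocity_def)
  have "U #>\<^bsub>G\<^esub> k \<in> carrier (Obj (Pi_functor G R) (K, U))"
    using kz(1) by (simp add: Pi_Obj[OF I(2)] with_topology_def carrier_FactGroup)
  then have "\<theta> (H, U) (Ind (Pi_functor G R) (H, U) (K, U) (U #>\<^bsub>G\<^esub> k)) =
      Ind (H0_functor G C) (H, U) (K, U) (norm_class K U z)"
    using PM.commute_Ind[of "(H, U)" "(K, U)"] I(3) assms(1) kz(3) by (simp add: layer_def)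
  moreover have "induced ((#>\<^bsub>G\<^esub>) U) (U #>\<^bsub>G\<^esub> k) = U #>\<^bsub>G\<^esub> k"
    by (rule induced_eq[OF self_mem_coset[OF I(2) kz(1)]]) (rule coset_rep(1)[OF I(2) kz(1)])
  then have "Ind (Pi_functor G R) (H, U) (K, U) (U #>\<^bsub>G\<^esub> k) = U #>\<^bsub>G\<^esub> k"
    by (simp add: Pi_functor_def layer_set_mult(1)[OF assms(1) layerD(1,4)[OF assms(1)] order_refl])
  moreover have "norm_class H U (Ind C H K x) = norm_class H U (Ind C H K z)"
    if "x \<in> norm_class K U z" for x
    by (rule norm_class_Ind[OF assms(1-4) _ kz(2)]) (rule mem_norm_class[OF KU(1,3,2) kz(2) that])+
  then have "induced (\<lambda>x. norm_class H U (Ind C H K x)) (norm_class K U z) =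
      norm_class H U (Ind C H K z)"
    by (rule induced_eq[OF self_mem_norm_class[OF I(2) kz(2)]])
  then have "Ind (H0_functor G C) (H, U) (K, U) (norm_class K U z) = norm_class H U (Ind C H K z)"
    by (simp add: H0_functor_def norm_class_def[symmetric])
  ultimately show ?thesis
    using kz assms(4) by (auto simp: reciprocity_def)
qed

lemma norm_class_mono:
  assumes "layer H U" "subgroup K G" "U \<subseteq> K" "K \<subseteq> H"
    and z: "z \<in> carrier (Obj C H)" "z' \<in> carrier (Obj C H)" "norm_class H U z = norm_class H U z'"
  shows "norm_class H K z = norm_class H K z'"
proof -
  note I = intermediate[OF assms(1-4)]
  note HK = layer_Mackey[OF I(1)] and KU = layer_Mackey[OF I(2)] and HU = layer_Mackey[OF assms(1)]
  interpret g: group_hom "Obj C U" "Obj C K" "Ind C K U"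
    using Ind_group_hom KU by blast
  obtain y where y: "y \<in> carrier (Obj C U)" "z = Ind C H U y \<otimes>\<^bsub>Obj C H\<^esub> z'"
    using z norm_class_eq_iff[OF HU(1,3,2) z(1,2)] by blast
  then have "z = Ind C H K (Ind C K U y) \<otimes>\<^bsub>Obj C H\<^esub> z'"
    using CF.Ind_Ind[OF HK(1,2) KU(2) y(1)] by simp
  then show ?thesis
    using norm_class_eq_iff[OF HK(1,3,2) z(1,2)] y(1) g.hom_closed by blast
qed

text \<open>Naturality of \<open>\<theta>\<close> for the induction from (H, U) to (H, K). The first
  component stays H, so that \<open>Ind C H H\<close> is the identity and both sides are
  projections.\<close>

lemma reciprocity_quotient:
  assumes "layer H U" "subgroup K G" "U \<subseteq> K" "K \<subseteq> H" and r: "reciprocity H U h z"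
  shows "reciprocity H K h z"
proof -
  note I = intermediate[OF assms(1-4)]
  note HK = layer_Mackey[OF I(1)] and HU = layer_Mackey[OF assms(1)]
  have hz: "h \<in> H" "z \<in> carrier (Obj C H)" "\<theta> (H, U) (U #>\<^bsub>G\<^esub> h) = norm_class H U z"
    using r by (auto simp: reciprocity_def)
  have "U #>\<^bsub>G\<^esub> h \<in> carrier (Obj (Pi_functor G R) (H, U))"
    using hz(1) by (simp add: Pi_Obj[OF assms(1)] with_topology_def carrier_FactGroup)
  then have "\<theta> (H, K) (Ind (Pi_functor G R) (H, K) (H, U) (U #>\<^bsub>G\<^esub> h)) =
      Ind (H0_functor G C) (H, K) (H, U) (norm_class H U z)"
    using PM.commute_Ind[of "(H, K)" "(H, U)"] I(1,4) hz(3) by (simp add: layer_def)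
  moreover have "U #>\<^bsub>G\<^esub> h \<subseteq> K #>\<^bsub>G\<^esub> h"
    using assms(3) by (auto simp: r_coset_def)
  then have "K #>\<^bsub>G\<^esub> x = K #>\<^bsub>G\<^esub> h" if "x \<in> U #>\<^bsub>G\<^esub> h" for x
    using coset_rep(1)[OF I(1) hz(1)] that by blast
  then have "induced ((#>\<^bsub>G\<^esub>) K) (U #>\<^bsub>G\<^esub> h) = K #>\<^bsub>G\<^esub> h"
    by (rule induced_eq[OF self_mem_coset[OF assms(1) hz(1)]])
  then have "Ind (Pi_functor G R) (H, K) (H, U) (U #>\<^bsub>G\<^esub> h) = K #>\<^bsub>G\<^esub> h"
    by (simp add: Pi_functor_def layer_set_mult(2)[OF assms(1-4)])
  moreover have "norm_class H K (Ind C H H x) = norm_class H K z" if "x \<in> norm_class H U z" for x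
    using norm_class_mono[OF assms(1-4) _ hz(2)] mem_norm_class[OF HU(1,3,2) hz(2) that]
      CF.Ind_id[OF HK(1)] by simp
  then have "Ind (H0_functor G C) (H, K) (H, U) (norm_class H U z) = norm_class H K z"
    using induced_eq[of z "norm_class H U z" "\<lambda>x. norm_class H K (Ind C H H x)"]
      self_mem_norm_class[OF assms(1) hz(2)]
    by (simp add: H0_functor_def norm_class_def[symmetric])
  ultimately show ?thesis
    using hz by (auto simp: reciprocity_def)
qed

text \<open>Elements of H normalize both K and U, so conjugation by g maps the groups at (K, U) to
  themselves, and \<open>\<theta>\<close> commutes with it.\<close>

lemma reciprocity_Con:
  assumes "layer H U" "subgroup K G" "U \<subseteq> K" "K \<subseteq> H" "g \<in> H" and r: "reciprocity K U k z"
  shows "reciprocity K U (g \<otimes>\<^bsub>G\<^esub> k \<otimes>\<^bsub>G\<^esub> inv\<^bsub>G\<^esub> g) (Con C g K z)"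
proof -
  note I = intermediate[OF assms(1-4)]
  note KU = layer_Mackey[OF I(2)] and L = layerD[OF assms(1)]
  have kz: "k \<in> K" "z \<in> carrier (Obj C K)" "\<theta> (K, U) (U #>\<^bsub>G\<^esub> k) = norm_class K U z"
    using r by (auto simp: reciprocity_def)
  have g: "g \<in> carrier G"
    using assms(5) L(1) subgroup.mem_carrier by metis
  have conj: "conj_set G g K = K" "conj_set G g U = U"
    using conj_layer[OF assms(1)] assms(2-5) L by auto
  have closed: "g \<otimes>\<^bsub>G\<^esub> x \<otimes>\<^bsub>G\<^esub> inv\<^bsub>G\<^esub> g \<in> X" if "x \<in> X" "X \<in> {U, K}" for x X
  proof -
    have "g \<otimes>\<^bsub>G\<^esub> x \<otimes>\<^bsub>G\<^esub> inv\<^bsub>G\<^esub> g \<in> conj_set G g X"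
      using that(1) by (auto simp: conj_set_def l_coset_def r_coset_def)
    then show ?thesis
      using that(2) conj by auto
  qed
  interpret c: group_hom "Obj C K" "Obj C K" "Con C g K"
    using Con_hom[OF KU(1) g conj(1)] .
  interpret cU: group_hom "Obj C U" "Obj C U" "Con C g U"
    using Con_hom[OF KU(3) g conj(2)] .
  interpret i: group_hom "Obj C U" "Obj C K" "Ind C K U"
    using Ind_group_hom KU by blast
  have "U #>\<^bsub>G\<^esub> k \<in> carrier (Obj (Pi_functor G R) (K, U))"
    using kz(1) by (simp add: Pi_Obj[OF I(2)] with_topology_def carrier_FactGroup)
  then have "\<theta> (K, U) (Con (Pi_functor G R) g (K, U) (U #>\<^bsub>G\<^esub> k)) =
      Con (H0_functor G C) g (K, U) (norm_class K U z)"
    using PM.commute_Con[OF g, of "(K, U)"] I(2) kz(3) conj by (simp add: layer_def conj_pair_def)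
  moreover have "U #>\<^bsub>G\<^esub> (g \<otimes>\<^bsub>G\<^esub> x \<otimes>\<^bsub>G\<^esub> inv\<^bsub>G\<^esub> g) = U #>\<^bsub>G\<^esub> (g \<otimes>\<^bsub>G\<^esub> k \<otimes>\<^bsub>G\<^esub> inv\<^bsub>G\<^esub> g)"
    if x: "x \<in> U #>\<^bsub>G\<^esub> k" for x
  proof (rule coset_rep(1)[OF I(2)])
    show "g \<otimes>\<^bsub>G\<^esub> k \<otimes>\<^bsub>G\<^esub> inv\<^bsub>G\<^esub> g \<in> K"
      using closed kz by blast
    obtain u where u: "u \<in> U" "x = u \<otimes>\<^bsub>G\<^esub> k"
      using x by (auto simp: r_coset_def)
    have "u \<in> carrier G" "k \<in> carrier G"
      using u kz(1) subgroup.mem_carrier L(2) assms(2) by metis+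
    moreover have "inv\<^bsub>G\<^esub> g \<otimes>\<^bsub>G\<^esub> (g \<otimes>\<^bsub>G\<^esub> y) = y" if "y \<in> carrier G" for y
      using that g by (simp add: G.m_assoc[symmetric])
    \<comment> \<open>As g normalizes U, the U-coset of the conjugate depends only on the U-coset of
      k.\<close>
    ultimately have "g \<otimes>\<^bsub>G\<^esub> x \<otimes>\<^bsub>G\<^esub> inv\<^bsub>G\<^esub> g =
        (g \<otimes>\<^bsub>G\<^esub> u \<otimes>\<^bsub>G\<^esub> inv\<^bsub>G\<^esub> g) \<otimes>\<^bsub>G\<^esub> (g \<otimes>\<^bsub>G\<^esub> k \<otimes>\<^bsub>G\<^esub> inv\<^bsub>G\<^esub> g)"
      using g u(2) by (simp add: G.m_assoc)
    then show "g \<otimes>\<^bsub>G\<^esub> x \<otimes>\<^bsub>G\<^esub> inv\<^bsub>G\<^esub> g \<in> U #>\<^bsub>G\<^esub> (g \<otimes>\<^bsub>G\<^esub> k \<otimes>\<^bsub>G\<^esub> inv\<^bsub>G\<^esub> g)"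
      using closed[OF u(1)] by (auto simp: r_coset_def)
  qed
  then have "induced (\<lambda>h. U #>\<^bsub>G\<^esub> (g \<otimes>\<^bsub>G\<^esub> h \<otimes>\<^bsub>G\<^esub> inv\<^bsub>G\<^esub> g)) (U #>\<^bsub>G\<^esub> k) =
      U #>\<^bsub>G\<^esub> (g \<otimes>\<^bsub>G\<^esub> k \<otimes>\<^bsub>G\<^esub> inv\<^bsub>G\<^esub> g)"
    by (rule induced_eq[OF self_mem_coset[OF I(2) kz(1)]])
  then have "Con (Pi_functor G R) g (K, U) (U #>\<^bsub>G\<^esub> k) = U #>\<^bsub>G\<^esub> (g \<otimes>\<^bsub>G\<^esub> k \<otimes>\<^bsub>G\<^esub> inv\<^bsub>G\<^esub> g)"
    by (simp add: Pi_functor_def layer_set_mult(1)[OF assms(1-4)] conj)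
  moreover have "norm_class K U (Con C g K x) = norm_class K U (Con C g K z)"
    if x: "x \<in> norm_class K U z" for x
  proof -
    have xK: "x \<in> carrier (Obj C K)" "norm_class K U x = norm_class K U z"
      using mem_norm_class[OF KU(1,3,2) kz(2) x] .
    then obtain y where y: "y \<in> carrier (Obj C U)" "x = Ind C K U y \<otimes>\<^bsub>Obj C K\<^esub> z"
      using norm_class_eq_iff[OF KU(1,3,2) xK(1) kz(2)] by blast
    then have "Con C g K x = Ind C K U (Con C g U y) \<otimes>\<^bsub>Obj C K\<^esub> Con C g K z"
      using CF.Con_Ind[OF g KU(1,2) y(1)] kz conj by simp
    then show ?thesis
      using norm_class_eq_iff[OF KU(1,3,2) c.hom_closed[OF xK(1)] c.hom_closed[OF kz(2)]]
        cU.hom_closed[OF y(1)] by blast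
  qed
  then have "induced (\<lambda>x. norm_class K U (Con C g K x)) (norm_class K U z) = norm_class K U (Con C g K z)"
    by (rule induced_eq[OF self_mem_norm_class[OF I(2) kz(2)]])
  then have "Con (H0_functor G C) g (K, U) (norm_class K U z) = norm_class K U (Con C g K z)"
    by (simp add: H0_functor_def norm_class_def[symmetric] conj)
  ultimately show ?thesis
    using kz closed[OF kz(1)] by (auto simp: reciprocity_def)
qed

section \<open>Reciprocity for abelian layers\<close>

text \<open>Surjectivity of \<open>\<theta>\<close> at (H, U) and triviality of its kernel, in terms
  of representatives.\<close>

definition reciprocal :: "'a set \<Rightarrow> 'a set \<Rightarrow> bool" where
  "reciprocal H U \<longleftrightarrow> (\<forall>z\<in>carrier (Obj C H). \<exists>h. reciprocity H U h z) \<and>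
     (\<forall>h. reciprocity H U h \<one>\<^bsub>Obj C H\<^esub> \<longrightarrow> h \<in> U)"

lemma norm_class_eq_one_iff:
  assumes "layer H U" "z \<in> carrier (Obj C H)"
  shows "norm_class H U z = norm_class H U \<one>\<^bsub>Obj C H\<^esub> \<longleftrightarrow> z \<in> norm_group C H U"
proof -
  note P = layer_Mackey[OF assms(1)]
  interpret h: group_hom "Obj C U" "Obj C H" "Ind C H U"
    using Ind_group_hom P by blast
  show ?thesis
    using norm_class_eq_iff[OF P(1,3,2) assms(2) h.H.one_closed]
    by (auto simp: norm_group_def)
qed

lemma bij_betw_iff_reciprocal:
  assumes "layer H U"
  shows "bij_betw (\<theta> (H, U)) (carrier (quot G H U)) (carrier (H0 C H U)) \<longleftrightarrow> reciprocal H U"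
proof -
  note L = layerD[OF assms] and P = layer_Mackey[OF assms]
  interpret h: group_hom "quot G H U" "H0 C H U" "\<theta> (H, U)"
    using theta_hom[OF assms] .
  have H: "H \<subseteq> carrier G"
    using L(1) subgroup.subset by blast
  have quot: "carrier (quot G H U) = (\<lambda>h. U #>\<^bsub>G\<^esub> h) ` H" "\<one>\<^bsub>quot G H U\<^esub> = U"
    by (simp_all add: carrier_FactGroup)
  have one: "\<one>\<^bsub>H0 C H U\<^esub> = norm_class H U \<one>\<^bsub>Obj C H\<^esub>"
    using reciprocity_one[OF assms] h.hom_one G.coset_mult_one subgroup.subset[OF L(2)] quot(2)
    by (metis reciprocity_def)
  have one_closed: "\<one>\<^bsub>Obj C H\<^esub> \<in> carrier (Obj C H)"
    using reciprocity_one[OF assms] by (simp add: reciprocity_def)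
  have coset: "U #>\<^bsub>G\<^esub> h = U \<longleftrightarrow> h \<in> U" if "h \<in> H" for h
    using that G.coset_join1[OF _ _ L(2), of h] G.coset_join2[OF _ L(2), of h] H L(4) by blast
  have closed: "\<theta> (H, U) (U #>\<^bsub>G\<^esub> h) \<in> carrier (H0 C H U)" if "h \<in> H" for h
    using that h.hom_closed quot(1) by blast
  have "inj_on (\<theta> (H, U)) (carrier (quot G H U)) \<longleftrightarrow>
      (\<forall>h\<in>H. \<theta> (H, U) (U #>\<^bsub>G\<^esub> h) = norm_class H U \<one>\<^bsub>Obj C H\<^esub> \<longrightarrow> U #>\<^bsub>G\<^esub> h = U)"
    unfolding h.inj_on_one_iff unfolding quot one by blast
  also have "\<dots> \<longleftrightarrow> (\<forall>h. reciprocity H U h \<one>\<^bsub>Obj C H\<^esub> \<longrightarrow> h \<in> U)"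
    using coset one_closed by (auto simp: reciprocity_def)
  finally have inj: "inj_on (\<theta> (H, U)) (carrier (quot G H U)) \<longleftrightarrow>
      (\<forall>h. reciprocity H U h \<one>\<^bsub>Obj C H\<^esub> \<longrightarrow> h \<in> U)" .
  have "\<theta> (H, U) ` carrier (quot G H U) = carrier (H0 C H U) \<longleftrightarrow>
      carrier (H0 C H U) \<subseteq> (\<lambda>h. \<theta> (H, U) (U #>\<^bsub>G\<^esub> h)) ` H"
    using closed by (auto simp: quot image_image)
  also have "\<dots> \<longleftrightarrow> (\<forall>z\<in>carrier (Obj C H). \<exists>h. reciprocity H U h z)"
    by (auto simp: carrier_H0 reciprocity_def image_iff subset_eq) metis+
  finally show ?thesis
    using inj by (auto simp: bij_betw_def reciprocal_def)
qed

text \<open>The place where the prime morphism and the class field axiom enter; all other layers are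
  reached by induction.\<close>

lemma prime_layer:
  assumes "layer H K" "prime q" "cyclic_quotient G H K q"
  shows "reciprocal H K"
    "\<lbrakk>x \<in> carrier (Obj C K); Ind C H K x = \<one>\<^bsub>Obj C H\<^esub>\<rbrakk> \<Longrightarrow> x \<in> aug_group C H K"
proof -
  show "reciprocal H K"
    using PM.prime_iso[OF _ _ assms(2,3)] assms(1) top_iso_iff bij_betw_iff_reciprocal
    by (simp add: layer_def)
  have "trivial_group (Hm1 C H K)"
    using prime_axiom[OF _ _ assms(2,3)] assms(1) by (simp add: layer_def class_field_axiom_def)
  then show "\<lbrakk>x \<in> carrier (Obj C K); Ind C H K x = \<one>\<^bsub>Obj C H\<^esub>\<rbrakk> \<Longrightarrow> x \<in> aug_group C H K"
    using trivial_Hm1_iff[OF assms(1)] by blast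
qed

text \<open>
  \<open>H\<close> acts trivially on \<open>K / U\<close>, hence by equivariance of \<open>\<theta>\<close> also on the norm residue group of
  \<open>(K, U)\<close>.
\<close>

lemma aug_subset_norm_group:
  assumes "layer H U" "subgroup K G" "U \<subseteq> K" "K \<subseteq> H" and rec: "reciprocal K U"
  shows "aug_group C H K \<subseteq> norm_group C K U"
proof -
  note I = intermediate[OF assms(1-4)]
  note KU = layer_Mackey[OF I(2)] and L = layerD[OF assms(1)]
  interpret K: comm_group "Obj C K"
    using Obj_comm_group KU by blast
  have N: "subgroup (norm_group C K U) (Obj C K)"
    using norm_group_normal[OF KU(1,3,2)] normal_imp_subgroup by blast
  have "Con C g K z \<otimes>\<^bsub>Obj C K\<^esub> inv\<^bsub>Obj C K\<^esub> z \<in> norm_group C K U"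
    if g: "g \<in> H" and z: "z \<in> carrier (Obj C K)" for g z
  proof -
    obtain k where k: "reciprocity K U k z"
      using rec z by (auto simp: reciprocal_def)
    then have kK: "k \<in> K"
      by (simp add: reciprocity_def)
    have gk: "g \<in> carrier G" "k \<in> carrier G"
      using g kK subgroup.mem_carrier[OF L(1)] subgroup.mem_carrier[OF assms(2)] by auto
    have r: "reciprocity K U (g \<otimes>\<^bsub>G\<^esub> k \<otimes>\<^bsub>G\<^esub> inv\<^bsub>G\<^esub> g) (Con C g K z)"
      using reciprocity_Con[OF assms(1-4) g k] .
    have "g \<otimes>\<^bsub>G\<^esub> k \<otimes>\<^bsub>G\<^esub> inv\<^bsub>G\<^esub> g = (g \<otimes>\<^bsub>G\<^esub> k \<otimes>\<^bsub>G\<^esub> inv\<^bsub>G\<^esub> g \<otimes>\<^bsub>G\<^esub> inv\<^bsub>G\<^esub> k) \<otimes>\<^bsub>G\<^esub> k"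
      using gk by (simp add: G.m_assoc)
    then have "g \<otimes>\<^bsub>G\<^esub> k \<otimes>\<^bsub>G\<^esub> inv\<^bsub>G\<^esub> g \<in> U #>\<^bsub>G\<^esub> k"
      using layer_commutator[OF assms(1) g, of k] kK assms(4) unfolding r_coset_def by blast
    then have "U #>\<^bsub>G\<^esub> (g \<otimes>\<^bsub>G\<^esub> k \<otimes>\<^bsub>G\<^esub> inv\<^bsub>G\<^esub> g) = U #>\<^bsub>G\<^esub> k"
      using coset_rep(1)[OF I(2) kK] by blast
    then have eq: "norm_class K U (Con C g K z) = norm_class K U z"
      using r k by (simp add: reciprocity_def)
    have c: "Con C g K z \<in> carrier (Obj C K)"
      using r by (simp add: reciprocity_def)
    interpret i: group_hom "Obj C U" "Obj C K" "Ind C K U"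
      using Ind_group_hom KU by blast
    obtain y where y: "y \<in> carrier (Obj C U)" "Con C g K z = Ind C K U y \<otimes>\<^bsub>Obj C K\<^esub> z"
      using norm_class_eq_iff[OF KU(1,3,2) c z] eq by blast
    then have "Con C g K z \<otimes>\<^bsub>Obj C K\<^esub> inv\<^bsub>Obj C K\<^esub> z = Ind C K U y"
      using z by (simp add: K.m_assoc)
    then show ?thesis
      using y(1) by (simp add: norm_group_def)
  qed
  then show ?thesis
    unfolding aug_group_def by (intro K.generate_subgroup_incl[OF _ N]) auto
qed

text \<open>The induction keeps U and varies H, since its hypothesis is applied to (K, U); the layer
  (H, K) is covered by \<open>prime_layer\<close>.\<close>

theorem layer_reciprocal:
  assumes "layer H U"
  shows "reciprocal H U"
  using assms
proof (induction "subgroup_index G H U" arbitrary: H rule: less_induct)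
  case less
  note HU = layer_Mackey[OF less.prems] and L = layerD[OF less.prems]
  interpret H: comm_group "Obj C H"
    using Obj_comm_group HU by blast
  show ?case
  proof (cases "U = H")
    case True
    \<comment> \<open>For U = H the norm is the identity, so every z is a norm and is matched with
      one.\<close>
    have "reciprocity H U \<one>\<^bsub>G\<^esub> z" if z: "z \<in> carrier (Obj C H)" for z
    proof (rule reciprocity_cong[OF reciprocity_one[OF less.prems]])
      have "z \<in> norm_group C H U"
        using z CF.Ind_id[OF HU(1) z] True unfolding norm_group_def by (metis imageI)
      then show "norm_class H U \<one>\<^bsub>Obj C H\<^esub> = norm_class H U z"
        using norm_class_eq_one_iff[OF less.prems z] by simp
    qed (use z L(1) subgroup.one_closed in auto)
    then show ?thesis
      using True by (auto simp: reciprocal_def reciprocity_def)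
  next
    case False
    obtain K q where K: "subgroup K G" "U \<subseteq> K" "K \<subset> H" and q: "prime q" "cyclic_quotient G H K q"
      using obtain_prime_layer[OF less.prems False] by blast
    have KH: "K \<subseteq> H"
      using K(3) by blast
    note I = intermediate[OF less.prems K(1,2) KH]
    note HK = layer_Mackey[OF I(1)] and KU = layer_Mackey[OF I(2)]
    have recK: "reciprocal K U"
      using less.hyps[OF index_less[OF less.prems K(3,2,1)] I(2)] .
    note recHK = prime_layer[OF I(1) q]
    interpret i: group_hom "Obj C K" "Obj C H" "Ind C H K"
      using Ind_group_hom HK by blast
    interpret j: group_hom "Obj C U" "Obj C K" "Ind C K U"
      using Ind_group_hom KU by blast
    \<comment> \<open>An h matched with z modulo norms from K is matched with some w modulo norms
      from U. Then z and w differ by the norm of some y in C(K), and the k matched with y corrects h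
      to k h.\<close>
    have surj: "\<exists>h. reciprocity H U h z" if z: "z \<in> carrier (Obj C H)" for z
    proof -
      obtain h where h: "reciprocity H K h z"
        using recHK(1) z by (auto simp: reciprocal_def)
      then obtain w where w: "reciprocity H U h w"
        using reciprocity_ex[OF less.prems] by (auto simp: reciprocity_def)
      then have wH: "w \<in> carrier (Obj C H)"
        by (simp add: reciprocity_def)
      have "norm_class H K z = norm_class H K w"
        using reciprocity_unique[OF h reciprocity_quotient[OF less.prems K(1,2) KH w]] .
      then obtain y where y: "y \<in> carrier (Obj C K)" "z = Ind C H K y \<otimes>\<^bsub>Obj C H\<^esub> w"
        using norm_class_eq_iff[OF HK(1,3,2) z wH] by blast
      then obtain k where "reciprocity K U k y"
        using recK by (auto simp: reciprocal_def)
      then have "reciprocity H U k (Ind C H K y)"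
        using reciprocity_Ind[OF less.prems K(1,2) KH] by blast
      then show ?thesis
        using reciprocity_mult[OF less.prems _ w] y(2) by blast
    qed
    have inj: "h \<in> U" if h: "reciprocity H U h \<one>\<^bsub>Obj C H\<^esub>" for h
    proof -
      have "h \<in> K"
        using reciprocity_quotient[OF less.prems K(1,2) KH h] recHK(1) by (simp add: reciprocal_def)
      then obtain y where y: "reciprocity K U h y"
        using reciprocity_ex[OF I(2)] by blast
      then have yK: "y \<in> carrier (Obj C K)"
        by (simp add: reciprocity_def)
      have "norm_class H U (Ind C H K y) = norm_class H U \<one>\<^bsub>Obj C H\<^esub>"
        using reciprocity_unique[OF reciprocity_Ind[OF less.prems K(1,2) KH y] h] .
      then obtain v where v: "v \<in> carrier (Obj C U)" "Ind C H K y = Ind C H U v"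
        using norm_class_eq_one_iff[OF less.prems i.hom_closed[OF yK]] by (auto simp: norm_group_def)
      \<comment> \<open>The norms to H of y and of \<open>Ind C K U v\<close> agree; their quotient
        is therefore in the augmentation group of (H, K), hence a norm from U. This makes y itself a
        norm from U.\<close>
      have "Ind C H K (y \<otimes>\<^bsub>Obj C K\<^esub> inv\<^bsub>Obj C K\<^esub> Ind C K U v) = \<one>\<^bsub>Obj C H\<^esub>"
        using v yK CF.Ind_Ind[OF HK(1,2) KU(2) v(1)] i.hom_closed[OF yK] by simp
      then have "y \<otimes>\<^bsub>Obj C K\<^esub> inv\<^bsub>Obj C K\<^esub> Ind C K U v \<in> aug_group C H K"
        using yK v(1) by (intro recHK(2)) auto
      then have "y \<otimes>\<^bsub>Obj C K\<^esub> inv\<^bsub>Obj C K\<^esub> Ind C K U v \<in> norm_group C K U"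
        using aug_subset_norm_group[OF less.prems K(1,2) KH recK] by blast
      then obtain u where u: "u \<in> carrier (Obj C U)"
        "y \<otimes>\<^bsub>Obj C K\<^esub> inv\<^bsub>Obj C K\<^esub> Ind C K U v = Ind C K U u"
        by (auto simp: norm_group_def)
      then have "y = Ind C K U (u \<otimes>\<^bsub>Obj C U\<^esub> v)"
        using i.G.inv_solve_right'[of "Ind C K U u" y "Ind C K U v"] yK v(1) by simp
      then have "y \<in> norm_group C K U"
        using j.G.m_closed[OF u(1) v(1)] unfolding norm_group_def by (rule image_eqI)
      then have "norm_class K U y = norm_class K U \<one>\<^bsub>Obj C K\<^esub>"
        using norm_class_eq_one_iff[OF I(2) yK] by blast
      then have "reciprocity K U h \<one>\<^bsub>Obj C K\<^esub>"
        using reciprocity_cong[OF y] \<open>h \<in> K\<close> by simp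
      then show ?thesis
        using recK by (simp add: reciprocal_def)
    qed
    show ?thesis
      using surj inj by (simp add: reciprocal_def)
  qed
qed

text \<open>Injectivity of C(K)/N C(U) -> C(H)/N C(U), for every intermediate K:
  \<open>\<theta>\<close>, now known to be bijective on both layers, identifies this map with the
  inclusion of K / U into H / U.\<close>

lemma norm_group_if_Ind:
  assumes "layer H U" "subgroup K G" "U \<subseteq> K" "K \<subseteq> H"
    and z: "z \<in> carrier (Obj C K)" "Ind C H K z \<in> norm_group C H U"
  shows "z \<in> norm_group C K U"
proof -
  note I = intermediate[OF assms(1-4)]
  interpret i: group_hom "Obj C K" "Obj C H" "Ind C H K"
    using Ind_group_hom layer_Mackey[OF I(1)] by blast
  obtain k where k: "reciprocity K U k z"
    using layer_reciprocal[OF I(2)] z(1) by (auto simp: reciprocal_def)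
  have r: "reciprocity H U k (Ind C H K z)"
    using reciprocity_Ind[OF assms(1-4) k] .
  then have "reciprocity H U k \<one>\<^bsub>Obj C H\<^esub>"
    using norm_class_eq_one_iff[OF assms(1) i.hom_closed[OF z(1)]] z(2)
    by (simp add: reciprocity_def)
  then have "k \<in> U"
    using layer_reciprocal[OF assms(1)] by (simp add: reciprocal_def)
  then have "U #>\<^bsub>G\<^esub> k = U #>\<^bsub>G\<^esub> \<one>\<^bsub>G\<^esub>"
    using layerD[OF assms(1)] G.coset_join2 subgroup.mem_carrier G.coset_mult_one subgroup.subset
    by metis
  then have "norm_class K U z = norm_class K U \<one>\<^bsub>Obj C K\<^esub>"
    using k reciprocity_one[OF I(2)] by (simp add: reciprocity_def)
  then show ?thesis
    using norm_class_eq_one_iff[OF I(2) z(1)] by blast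
qed

section \<open>Vanishing of \<open>H\<^sup>-\<^sup>1\<close> for cyclic layers\<close>

text \<open>Natural exponents suffice because H / U is finite, and they allow induction on the
  exponent.\<close>

definition generates_mod :: "'a set \<Rightarrow> 'a set \<Rightarrow> 'a \<Rightarrow> bool" where
  "generates_mod H U s \<longleftrightarrow>
    s \<in> H \<and> (\<forall>h\<in>H. \<exists>k::nat. U #>\<^bsub>G\<^esub> h = U #>\<^bsub>G\<^esub> (s [^]\<^bsub>G\<^esub> k))"

lemma cyclic_quotient_generator:
  assumes "layer H U" "cyclic_quotient G H U n"
  obtains s where "generates_mod H U s"
proof -
  note L = layerD[OF assms(1)]
  interpret U: normal U "G\<lparr>carrier := H\<rparr>"
    using L(3) .
  interpret Q: group "quot G H U"
    using U.factorgroup_is_group .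
  have "finite (carrier (quot G H U))"
    using L(6) by (simp add: finite_index_def FactGroup_def)
  moreover obtain X where X: "X \<in> carrier (quot G H U)"
    "carrier (quot G H U) = range (\<lambda>n::int. X [^]\<^bsub>quot G H U\<^esub> n)"
    using assms(2) Q.cyclic_group by (auto simp: cyclic_quotient_def)
  \<comment> \<open>In a finite group the integer powers of an element are already its natural
    powers.\<close>
  ultimately have carr: "carrier (quot G H U) = {X [^]\<^bsub>quot G H U\<^esub> k | k. k \<in> (UNIV :: nat set)}"
    using Q.generate_pow_on_finite_carrier[OF _ X(1)] Q.generate_pow[OF X(1)]
    by (simp add: full_SetCompr_eq)
  obtain s where s: "s \<in> H" "X = U #>\<^bsub>G\<^esub> s"
    using X(1) by (auto simp: carrier_FactGroup)
  have "X [^]\<^bsub>quot G H U\<^esub> k = U #>\<^bsub>G\<^esub> (s [^]\<^bsub>G\<^esub> k)" for k :: nat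
    using U.FactGroup_pow[of s k] s by (simp add: G.nat_pow_consistent[symmetric])
  then have "\<exists>k::nat. U #>\<^bsub>G\<^esub> h = U #>\<^bsub>G\<^esub> (s [^]\<^bsub>G\<^esub> k)" if "h \<in> H" for h
  proof -
    have "U #>\<^bsub>G\<^esub> h \<in> carrier (quot G H U)"
      using that by (simp add: carrier_FactGroup)
    then show ?thesis
      using carr \<open>\<And>k. X [^]\<^bsub>quot G H U\<^esub> k = U #>\<^bsub>G\<^esub> (s [^]\<^bsub>G\<^esub> k)\<close> by auto
  qed
  then have "generates_mod H U s"
    using s(1) by (simp add: generates_mod_def)
  then show thesis
    by (rule that)
qed

lemma generates_mod_quotient:
  assumes "layer H U" "subgroup K G" "U \<subseteq> K" "K \<subseteq> H" "generates_mod H U s"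
  shows "generates_mod H K s"
proof -
  note L = layerD[OF assms(1)]
  have sk: "s [^]\<^bsub>G\<^esub> (k::nat) \<in> H" for k
    using assms(5) subgroup.one_closed[OF L(1)] subgroup.m_closed[OF L(1)]
    by (induction k) (auto simp: generates_mod_def)
  have "\<exists>k::nat. K #>\<^bsub>G\<^esub> h = K #>\<^bsub>G\<^esub> (s [^]\<^bsub>G\<^esub> k)" if h: "h \<in> H" for h
  proof -
    obtain k :: nat where "U #>\<^bsub>G\<^esub> h = U #>\<^bsub>G\<^esub> (s [^]\<^bsub>G\<^esub> k)"
      using assms(5) h by (auto simp: generates_mod_def)
    then have "h \<in> U #>\<^bsub>G\<^esub> (s [^]\<^bsub>G\<^esub> k)"
      using self_mem_coset[OF assms(1) h] by simp
    then have "h \<in> K #>\<^bsub>G\<^esub> (s [^]\<^bsub>G\<^esub> k)"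
      using assms(3) by (auto simp: r_coset_def)
    then show ?thesis
      using coset_rep(1)[OF intermediate(1)[OF assms(1-4)] sk] by blast
  qed
  then show ?thesis
    using assms(5) by (simp add: generates_mod_def)
qed

lemma generates_mod_prime_index:
  assumes "layer H U" "subgroup K G" "U \<subseteq> K" "K \<subset> H" "generates_mod H U s"
    and q: "prime q" "cyclic_quotient G H K q"
  shows "generates_mod K U (s [^]\<^bsub>G\<^esub> q)"
proof -
  note L = layerD[OF assms(1)]
  have KH: "K \<subseteq> H"
    using assms(4) by blast
  interpret H: group "G\<lparr>carrier := H\<rparr>"
    using L(1) by (simp add: G.subgroup_imp_group)
  have order: "order (quot G H K) = q"
    using q(2) by (simp add: cyclic_quotient_def)
  have gen: "\<exists>k::nat. U #>\<^bsub>G\<lparr>carrier := H\<rparr>\<^esub> x = U #>\<^bsub>G\<lparr>carrier := H\<rparr>\<^esub> s [^]\<^bsub>G\<lparr>carrier := H\<rparr>\<^esub> k"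
    if "x \<in> carrier (G\<lparr>carrier := H\<rparr>)" for x
    using assms(5) that by (simp add: generates_mod_def G.nat_pow_consistent[symmetric])
  note * = H.cyclic_mod_prime_index[OF normal_imp_subgroup[OF L(3)] assms(3)
      normal_intermediate[OF assms(1-3) KH] _ _ _ gen, unfolded order]
  show ?thesis
    using *[OF _ q(1)] assms(4,5)
    by (auto simp: generates_mod_def G.nat_pow_consistent[symmetric])
qed

text \<open>As C(K) is commutative, z -> s z / z is an endomorphism, so its image is a subgroup.
  This image contains all generators of the augmentation group: powers of s are handled by
  telescoping, and elements of K act trivially on C(K).\<close>

lemma aug_group_cyclic:
  assumes "layer H K" "generates_mod H K s" "a \<in> aug_group C H K"
  obtains z where "z \<in> carrier (Obj C K)" "a = Con C s K z \<otimes>\<^bsub>Obj C K\<^esub> inv\<^bsub>Obj C K\<^esub> z"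
proof -
  note P = layer_Mackey[OF assms(1)] and L = layerD[OF assms(1)]
  interpret K: comm_group "Obj C K"
    using Obj_comm_group P by blast
  have hom: "group_hom (Obj C K) (Obj C K) (Con C h K)" and inG: "h \<in> carrier G"
    and conj: "conj_set G h K = K" if "h \<in> H" for h
  proof -
    show "h \<in> carrier G"
      using subgroup.mem_carrier[OF L(1) that] .
    moreover show "conj_set G h K = K"
      using conj_layer[OF assms(1) L(2) order_refl L(4) that] .
    ultimately show "group_hom (Obj C K) (Obj C K) (Con C h K)"
      using Con_hom[OF P(3)] by blast
  qed
  have s: "s \<in> H"
    using assms(2) by (simp add: generates_mod_def)
  interpret c: group_hom "Obj C K" "Obj C K" "Con C s K"
    using hom[OF s] .
  let ?f = "\<lambda>z. Con C s K z \<otimes>\<^bsub>Obj C K\<^esub> inv\<^bsub>Obj C K\<^esub> z"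
  have "?f \<in> hom (Obj C K) (Obj C K)"
    by (rule homI) (simp_all add: K.inv_mult K.m_ac)
  then interpret f: group_hom "Obj C K" "Obj C K" ?f
    by unfold_locales
  let ?S = "?f ` carrier (Obj C K)"
  have S: "subgroup ?S (Obj C K)"
    by (rule f.img_is_subgroup)
  have sk: "s [^]\<^bsub>G\<^esub> (k::nat) \<in> H" for k
    using s subgroup.one_closed[OF L(1)] subgroup.m_closed[OF L(1)] by (induction k) auto
  have pow: "Con C (s [^]\<^bsub>G\<^esub> k) K x \<otimes>\<^bsub>Obj C K\<^esub> inv\<^bsub>Obj C K\<^esub> x \<in> ?S"
    if "x \<in> carrier (Obj C K)" for k :: nat and x
    using that
  proof (induction k arbitrary: x)
    case 0
    then have "Con C (s [^]\<^bsub>G\<^esub> (0::nat)) K x \<otimes>\<^bsub>Obj C K\<^esub> inv\<^bsub>Obj C K\<^esub> x = \<one>\<^bsub>Obj C K\<^esub>"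
      using CF.Con_one[OF P(3)] by simp
    then show ?case
      using subgroup.one_closed[OF S] by (simp only:)
  next
    case (Suc k)
    let ?x = "Con C s K x" and ?a = "Con C (s [^]\<^bsub>G\<^esub> k) K (Con C s K x)"
    have x: "?x \<in> carrier (Obj C K)"
      using Suc.prems by simp
    then have a: "?a \<in> carrier (Obj C K)"
      using group_hom.hom_closed[OF hom[OF sk]] by blast
    have "Con C (s [^]\<^bsub>G\<^esub> Suc k) K x = ?a"
      using CF.Con_Con[OF inG[OF s] inG[OF sk] P(3) Suc.prems] conj[OF s] by simp
    \<comment> \<open>Telescoping: the factor for s^k is taken at s x instead of x, which is why the
      induction is over arbitrary x.\<close>
    moreover have "?a \<otimes>\<^bsub>Obj C K\<^esub> inv\<^bsub>Obj C K\<^esub> x =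
        (?a \<otimes>\<^bsub>Obj C K\<^esub> inv\<^bsub>Obj C K\<^esub> ?x) \<otimes>\<^bsub>Obj C K\<^esub> ?f x"
    proof -
      have "inv\<^bsub>Obj C K\<^esub> ?x \<otimes>\<^bsub>Obj C K\<^esub> (?x \<otimes>\<^bsub>Obj C K\<^esub> inv\<^bsub>Obj C K\<^esub> x) = inv\<^bsub>Obj C K\<^esub> x"
        using x Suc.prems by (simp add: K.m_assoc[symmetric] del: c.hom_closed)
      then show ?thesis
        using x a Suc.prems by (simp add: K.m_assoc)
    qed
    moreover have "?f x \<in> ?S"
      using Suc.prems by (rule imageI)
    then have "(?a \<otimes>\<^bsub>Obj C K\<^esub> inv\<^bsub>Obj C K\<^esub> ?x) \<otimes>\<^bsub>Obj C K\<^esub> ?f x \<in> ?S"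
      by (rule subgroup.m_closed[OF S Suc.IH[OF x]])
    ultimately show ?case
      by (simp only:)
  qed
  have "Con C h K x \<otimes>\<^bsub>Obj C K\<^esub> inv\<^bsub>Obj C K\<^esub> x \<in> ?S"
    if h: "h \<in> H" and x: "x \<in> carrier (Obj C K)" for h x
  proof -
    obtain k :: nat where "K #>\<^bsub>G\<^esub> h = K #>\<^bsub>G\<^esub> (s [^]\<^bsub>G\<^esub> k)"
      using assms(2) h by (auto simp: generates_mod_def)
    then have "h \<in> K #>\<^bsub>G\<^esub> (s [^]\<^bsub>G\<^esub> k)"
      using self_mem_coset[OF assms(1) h] by simp
    then obtain u where u: "u \<in> K" "h = u \<otimes>\<^bsub>G\<^esub> (s [^]\<^bsub>G\<^esub> k)"
      by (auto simp: r_coset_def)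
    have "Con C h K x = Con C u K (Con C (s [^]\<^bsub>G\<^esub> k) K x)"
      using CF.Con_Con[OF inG[OF sk] _ P(3) x, of u k] conj[OF sk] u inG L(4) by auto
    also have "\<dots> = Con C (s [^]\<^bsub>G\<^esub> k) K x"
      using CF.stable[OF P(3) u(1)] group_hom.hom_closed[OF hom[OF sk] x] by blast
    finally show ?thesis
      using pow[OF x] by simp
  qed
  then have "aug_group C H K \<subseteq> ?S"
    unfolding aug_group_def by (intro K.generate_subgroup_incl[OF _ S]) auto
  then show thesis
    using that assms(3) by blast
qed

text \<open>
  With \<open>K\<close> of prime index \<open>q\<close> in \<open>H\<close> and \<open>s\<close> a generator of \<open>H / U\<close>, the norm of \<open>x\<close> to \<open>K\<close> is
  \<open>s z / z\<close>. The class of \<open>z\<close> corresponds to a \<open>q\<close>-th power in \<open>H / U\<close>, so it is the class of a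
  restriction \<open>Res w\<close> by the cohomological formula; as \<open>Res w\<close> is fixed by \<open>s\<close>, one may take \<open>z\<close>
  to be a norm from \<open>U\<close>.
\<close>

lemma kernel_subset_aug_group:
  assumes "layer H U" "generates_mod H U s"
    and "x \<in> carrier (Obj C U)" "Ind C H U x = \<one>\<^bsub>Obj C H\<^esub>"
  shows "x \<in> aug_group C H U"
  using assms
proof (induction "subgroup_index G H U" arbitrary: H s x rule: less_induct)
  case less
  note HU = layer_Mackey[OF less.prems(1)] and L = layerD[OF less.prems(1)]
  note x = less.prems(3)
  interpret H: comm_group "Obj C H"
    using Obj_comm_group HU by blast
  show ?case
  proof (cases "U = H")
    case True
    then have "x = \<one>\<^bsub>Obj C U\<^esub>"
      using CF.Ind_id[OF HU(1)] less.prems(3,4) by simp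
    then show ?thesis
      by (simp add: aug_group_def generate.one)
  next
    case False
    obtain K q where K: "subgroup K G" "U \<subseteq> K" "K \<subset> H" and q: "prime q" "cyclic_quotient G H K q"
      using obtain_prime_layer[OF less.prems(1) False] by blast
    have KH: "K \<subseteq> H"
      using K(3) by blast
    note I = intermediate[OF less.prems(1) K(1,2) KH]
    note HK = layer_Mackey[OF I(1)] and KU = layer_Mackey[OF I(2)]
    interpret K: comm_group "Obj C K"
      using Obj_comm_group HK by blast
    interpret U: comm_group "Obj C U"
      using Obj_comm_group HU by blast
    interpret i: group_hom "Obj C K" "Obj C H" "Ind C H K"
      using Ind_group_hom HK by blast
    interpret j: group_hom "Obj C U" "Obj C K" "Ind C K U"
      using Ind_group_hom KU by blast
    have s: "s \<in> H" "s \<in> carrier G"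
      using less.prems(2) L(1) subgroup.mem_carrier by (auto simp: generates_mod_def)
    have conj: "conj_set G s K = K" "conj_set G s U = U" "conj_set G s H = H"
      using conj_layer[OF less.prems(1) _ _ _ s(1)] K L KH by auto
    interpret cK: group_hom "Obj C K" "Obj C K" "Con C s K"
      using Con_hom[OF HK(3) s(2) conj(1)] .
    interpret cU: group_hom "Obj C U" "Obj C U" "Con C s U"
      using Con_hom[OF HU(3) s(2) conj(2)] .
    have "Ind C H K (Ind C K U x) = \<one>\<^bsub>Obj C H\<^esub>"
      using CF.Ind_Ind[OF HK(1,2) KU(2) x] less.prems(4) by simp
    then have "Ind C K U x \<in> aug_group C H K"
      using prime_layer(2)[OF I(1) q] x by simp
    then obtain z where z: "z \<in> carrier (Obj C K)"
      "Ind C K U x = Con C s K z \<otimes>\<^bsub>Obj C K\<^esub> inv\<^bsub>Obj C K\<^esub> z"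
      using aug_group_cyclic[OF I(1) generates_mod_quotient[OF less.prems(1) K(1,2) KH less.prems(2)]]
      by blast
    obtain k where k: "reciprocity K U k z"
      using layer_reciprocal[OF I(2)] z(1) by (auto simp: reciprocal_def)
    then have kK: "k \<in> K"
      by (simp add: reciprocity_def)
    have genK: "generates_mod K U (s [^]\<^bsub>G\<^esub> q)"
      using generates_mod_prime_index[OF less.prems(1) K less.prems(2) q] .
    obtain m :: nat where m: "U #>\<^bsub>G\<^esub> k = U #>\<^bsub>G\<^esub> ((s [^]\<^bsub>G\<^esub> q) [^]\<^bsub>G\<^esub> m)"
      using genK kK by (auto simp: generates_mod_def)
    \<comment> \<open>The class of k is a power of s^q, hence the q-th power of the class of s^m; w
      is chosen to match s^m.\<close>
    have "(s [^]\<^bsub>G\<^esub> q) [^]\<^bsub>G\<^esub> m = (s [^]\<^bsub>G\<^esub> m) [^]\<^bsub>G\<^esub> q"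
      using s(2) by (simp add: G.nat_pow_pow mult.commute)
    then have m': "U #>\<^bsub>G\<^esub> k = U #>\<^bsub>G\<^esub> ((s [^]\<^bsub>G\<^esub> m) [^]\<^bsub>G\<^esub> q)"
      using m by simp
    have "s [^]\<^bsub>G\<^esub> m \<in> H"
      using s(1) subgroup.one_closed[OF L(1)] subgroup.m_closed[OF L(1)] by (induction m) auto
    then obtain w where w: "reciprocity H U (s [^]\<^bsub>G\<^esub> m) w"
      using reciprocity_ex[OF less.prems(1)] by blast
    then have wH: "w \<in> carrier (Obj C H)"
      by (simp add: reciprocity_def)
    define r where "r = Res C K H w"
    have "Res C K H \<in> hom (Obj C H) (Obj C K)"
      using CF.Res[OF HK(1) I(5)] by (simp add: top_hom_def)
    then have r: "r \<in> carrier (Obj C K)"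
      using wH by (auto simp: r_def hom_def)
    \<comment> \<open>The exponent is the index [H : K] = q. Here K has to admit both restriction
      and induction.\<close>
    have "Ind C H K r = w [^]\<^bsub>Obj C H\<^esub> q"
      using CF.cohomological[OF HK(1) _ layerD(6)[OF I(1)] wH] I(5) HK(2) q(2)
      by (simp add: r_def cyclic_quotient_def subgroup_index_def order_def FactGroup_def)
    then have "norm_class H U (Ind C H K r) = norm_class H U (Ind C H K z)"
      using reciprocity_pow[OF less.prems(1) w, of q] m'
        reciprocity_Ind[OF less.prems(1) K(1,2) KH k]
      by (simp add: reciprocity_def)
    then obtain v where v: "v \<in> carrier (Obj C U)"
      "Ind C H K z = Ind C H U v \<otimes>\<^bsub>Obj C H\<^esub> Ind C H K r"
      using norm_class_eq_iff[OF HU(1,3,2) i.hom_closed[OF z(1)] i.hom_closed[OF r]] by metis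
    have vH: "Ind C H U v \<in> carrier (Obj C H)"
      using group_hom.hom_closed[OF Ind_group_hom[OF HU(1,3,2)] v(1)] .
    \<comment> \<open>The norm of z / r to H is a norm from U; by injectivity between the norm
      residue groups, z / r is already one in C(K).\<close>
    have "Ind C H K (z \<otimes>\<^bsub>Obj C K\<^esub> inv\<^bsub>Obj C K\<^esub> r) = Ind C H U v"
      using z(1) r v(2) vH by (simp add: H.m_assoc)
    then have "z \<otimes>\<^bsub>Obj C K\<^esub> inv\<^bsub>Obj C K\<^esub> r \<in> norm_group C K U"
      using norm_group_if_Ind[OF less.prems(1) K(1,2) KH] z(1) r v(1) by (simp add: norm_group_def)
    then obtain y where y: "y \<in> carrier (Obj C U)" "z \<otimes>\<^bsub>Obj C K\<^esub> inv\<^bsub>Obj C K\<^esub> r = Ind C K U y"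
      by (auto simp: norm_group_def)
    have zy: "z = Ind C K U y \<otimes>\<^bsub>Obj C K\<^esub> r"
      using z(1) r y by (metis K.inv_solve_right' j.hom_closed)
    have "Con C s K r = r"
      using CF.Con_Res[OF s(2) HK(1) I(5) wH] CF.stable[OF HK(1) s(1) wH] conj by (simp add: r_def)
    then have "Con C s K z = Ind C K U (Con C s U y) \<otimes>\<^bsub>Obj C K\<^esub> r"
      using CF.Con_Ind[OF s(2) KU(1,2) y(1)] conj y(1) r zy by simp
    then have "Ind C K U x = (Ind C K U (Con C s U y) \<otimes>\<^bsub>Obj C K\<^esub> r)
        \<otimes>\<^bsub>Obj C K\<^esub> inv\<^bsub>Obj C K\<^esub> (Ind C K U y \<otimes>\<^bsub>Obj C K\<^esub> r)"
      using z(2) zy by simp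
    also have "\<dots> = Ind C K U (Con C s U y) \<otimes>\<^bsub>Obj C K\<^esub> inv\<^bsub>Obj C K\<^esub> (Ind C K U y)"
    proof -
      have "r \<otimes>\<^bsub>Obj C K\<^esub> (inv\<^bsub>Obj C K\<^esub> r \<otimes>\<^bsub>Obj C K\<^esub> b) = b" if "b \<in> carrier (Obj C K)" for b
        using that r by (simp add: K.m_assoc[symmetric])
      then show ?thesis
        using r y(1) by (simp add: K.inv_mult_group K.m_assoc)
    qed
    finally have eq: "Ind C K U x = Ind C K U (Con C s U y) \<otimes>\<^bsub>Obj C K\<^esub> inv\<^bsub>Obj C K\<^esub> (Ind C K U y)" .
    \<comment> \<open>The element a = s y / y has the same norm to K as x and lies in the
      augmentation group of (H, U). The quotient x / a is in the kernel of the norm to K, where the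
      induction hypothesis applies with the generator s^q of K / U.\<close>
    define a where "a = Con C s U y \<otimes>\<^bsub>Obj C U\<^esub> inv\<^bsub>Obj C U\<^esub> y"
    have a: "a \<in> carrier (Obj C U)" "Ind C K U a = Ind C K U x"
      using y(1) eq by (simp_all add: a_def)
    have a_aug: "a \<in> aug_group C H U"
      using s(1) y(1) unfolding a_def aug_group_def by (blast intro: generate.incl)
    have "Ind C K U (x \<otimes>\<^bsub>Obj C U\<^esub> inv\<^bsub>Obj C U\<^esub> a) = \<one>\<^bsub>Obj C K\<^esub>"
      using x a by simp
    then have "x \<otimes>\<^bsub>Obj C U\<^esub> inv\<^bsub>Obj C U\<^esub> a \<in> aug_group C K U"
      using less.hyps[OF index_less[OF less.prems(1) K(3,2,1)] I(2) genK] x a(1) by simp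
    moreover have "aug_group C K U \<subseteq> aug_group C H U"
      unfolding aug_group_def using KH by (intro U.mono_generate) auto
    ultimately have "(x \<otimes>\<^bsub>Obj C U\<^esub> inv\<^bsub>Obj C U\<^esub> a) \<otimes>\<^bsub>Obj C U\<^esub> a \<in> aug_group C H U"
      using a_aug unfolding aug_group_def by (blast intro: generate.eng)
    then show ?thesis
      using x a(1) by (simp add: U.m_assoc)
  qed
qed

end

theorem theorem3p5p10:
  fixes G :: "'a top_group"
    and E :: "('a set \<times> 'a set) ric_data"
    and R :: "'a set \<Rightarrow> 'a set"
    and M :: "'a set ric_data"
    and C :: "('a set, 'a, 'c) ric_functor_data"
    and \<theta> :: "'a set \<times> 'a set \<Rightarrow> 'a set \<Rightarrow> 'c set"
  assumes "topological_group G" and "compact_space (topo G)" and "Hausdorff_space (topo G)"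
    and "I_coherent G E R"
    and "mackey_cover G E M" and "arithmetic_system G M"
    and "cohomological_mackey_functor G M C"
    and "\<And>H U (l::nat). \<lbrakk>(H, U) \<in> points E; R H \<subseteq> U; prime l; cyclic_quotient G H U l\<rbrakk>
           \<Longrightarrow> class_field_axiom G C H U"
    and "prime_morphism G E R C \<theta>"
  shows "(\<forall>(H, U)\<in>points E. R H \<subseteq> U \<longrightarrow>
            \<theta> (H, U) \<in> top_iso (Obj (Pi_functor G R) (H, U)) (Obj (H0_functor G C) (H, U))) \<and>
         (\<forall>(H, U)\<in>points E. \<forall>(l::nat) (m::nat). R H \<subseteq> U \<and> prime l \<and> cyclic_quotient G H U (l ^ m) \<longrightarrow>
            trivial_group (Hm1 C H U))"
proof -
  interpret class_field_setting G E R M C \<theta>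
    using assms by (intro class_field_setting.intro class_field_setting_axioms.intro)
  have "\<theta> (H, U) \<in> top_iso (Obj (Pi_functor G R) (H, U)) (Obj (H0_functor G C) (H, U))"
    if "layer H U" for H U
    using top_iso_iff bij_betw_iff_reciprocal layer_reciprocal that by blast
  moreover have "trivial_group (Hm1 C H U)" if "layer H U" "cyclic_quotient G H U n" for H U n
    using trivial_Hm1_iff[OF that(1)] kernel_subset_aug_group[OF that(1)]
      cyclic_quotient_generator[OF that] by blast
  ultimately show ?thesis
    by (auto simp: layer_def)
qed

end
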